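(* Let $\mathcal{E},\mathcal{F},\mathcal{G}$ be bundle event structures with internal probability (ipBES) over a finite state space $\Omega$. Then \begin{align*} \mathcal{E}\|\mathcal{F}&\equiv_{\mathrm{sim}}\mathcal{F}\|\mathcal{E},\\ \mathcal{E}\|(\mathcal{F}\|\mathcal{G})&\equiv_{\mathrm{sim}}(\mathcal{E}\|\mathcal{F})\|\mathcal{G},\\ \mathcal{E}*\mathcal{F}&\equiv_{\mathrm{sim}}\mathcal{F}+\mathcal{E}\cdot(\mathcal{E}*\mathcal{F}),\\ \mathcal{E}\sqsubseteq_{\mathrm{sim}}\mathcal{F}&\Rightarrow\mathcal{G}+\mathcal{E}\sqsubseteq_{\mathrm{sim}}\mathcal{G}+\mathcal{F},\\ \mathcal{E}\sqsubseteq_{\mathrm{sim}}\mathcal{F}&\Rightarrow\mathcal{G}\cdot\mathcal{E}\sqsubseteq_{\mathrm{sim}}\mathcal{G}\cdot\mathcal{F},\\ \mathcal{E}\sqsubseteq_{\mathrm{sim}}\mathcal{F}&\Rightarrow\mathcal{E}\|\mathcal{G}\sqsubseteq_{\mathrm{sim}}\mathcal{F}\|\mathcal{G}. \end{align*}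
   Context: **Programs.** $\Omega$ is a fixed finite set of states. $\mathbb{D}\Omega$ is the set of distributions on $\Omega$, viewed inside $\mathbb{R}^\Omega$; $\delta_s$ is the point distribution at $s$. $\mathbb{H}_1\Omega$ is the set of maps $r:\Omega\to\mathcal{P}(\mathbb{D}\Omega)$ such that each $r(s)$ is non-empty, convex and topologically closed. A test is a map $b:\Omega\to\mathcal{P}(\mathbb{D}\Omega)$ with $b(s)\subseteq\{\delta_s\}$. $\overline{\mathbb{H}}_1\Omega$ is $\mathbb{H}_1\Omega$ together with all tests, ordered by $r\sqsubseteq_{\mathbb{H}}r'$ iff $r(s)\subseteq r'(s)$ for all $s$. $\delta$ denotes the program $\delta(s)=\{\delta_s\}$. **ipBES.** An ipBES is $\mathcal{E}=(E,\mapsto,\#,\lambda,\mathbf{\Phi})$ where $E$ is a set of events; $\#$ is an irreflexive symmetric relation on $E$; for $x,x'\subseteq E$, $x\#x'$ means $e\#e'$ for all $e\in x,e'\in x'$ with $e\ne e'$; $\mapsto\subseteq\mathcal{P}(E)\times E$ satisfies $x\#x$ whenever $x\mapsto e$; $\lambda:E\to\overline{\mathbb{H}}_1\Omega$; $\mathbf{\Phi}\subseteq\mathcal{P}(E)$ with $x\#x$ for $x\in\mathbf{\Phi}$. $\mathbf{in}(\mathcal{E})$ is the set of initial events, i.e. events $e$ with no bundle $x\mapsto e$. **Traces.** A finite trace is a finite sequence $e_1\cdots e_n$ of distinct, pairwise non-conflicting events such that for every $j$ and every bundle $x\mapsto e_j$ there is $i<j$ with $e_i\in x$. $\mathcal{T}(\mathcal{E})$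 is the set of finite traces (empty trace $\emptyset$), $\mathcal{T}_{\max}(\mathcal{E})$ the set of prefix-maximal ones. A trace $\alpha$ is weakly maximal if it is maximal or there are events $e_1,\dots,e_n$ with $\alpha e_1\cdots e_n\in\mathcal{T}_{\max}(\mathcal{E})$ and $\delta\sqsubseteq_{\mathbb{H}}\lambda(e_i)$ for all $i$. **t-simulation.** A function $f:\mathcal{T}(\mathcal{E})\to\mathcal{T}(\mathcal{F})$ is a t-simulation if: (i) $f(\emptyset)=\emptyset$ and $f^{-1}(\beta)$ is finite for every $\beta\in\mathcal{T}(\mathcal{F})$; (ii) if $\alpha e\in\mathcal{T}(\mathcal{E})$ then either $f(\alpha e)=f(\alpha)$ and $\lambda(e)\sqsubseteq_{\mathbb{H}}\delta$, or there is an event $e'$ of $\mathcal{F}$ with $\lambda(e)\sqsubseteq_{\mathbb{H}}\lambda(e')$ and $f(\alpha e)=f(\alpha)e'$; (iii) if $\alpha e$ is maximal in $\mathcal{T}(\mathcal{E})$ then $f(\alpha e)=f(\alpha)e'$ for some $e'$ with $\lambda(e)\sqsubseteq_{\mathbb{H}}\lambda(e')$, and $f(\alpha e)$ is weakly maximal in $\mathcal{T}(\mathcal{F})$. $\mathcal{E}\sqsubseteq_{\mathrm{sim}}\mathcal{F}$ means there is a t-simulation from $\mathcal{E}$ to $\mathcal{F}$; $\mathcal{E}\equiv_{\mathrm{sim}}\mathcal{F}$ means $\mathcal{E}\sqsubseteq_{\mathrm{sim}}\mathcal{F}$ and $\mathcal{F}\sqsubseteq_{\mathrm{sim}}\mathcal{E}$.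 **Operations on ipBES** (event sets of the operands are taken disjoint, renaming events, i.e. using fresh copies, if necessary). - $0$ is the structure with no events and $\mathbf{\Phi}=\emptyset$; by convention $0+\mathcal{E}=\mathcal{E}+0=\mathcal{E}$ and $0\cdot\mathcal{E}=\mathcal{E}\cdot0=\mathcal{E}$. - $\mathcal{E}+\mathcal{F}$ has events $E\cup F$, bundles $\mapsto_{\mathcal{E}}\cup\mapsto_{\mathcal{F}}$, labels $\lambda_{\mathcal{E}}\cup\lambda_{\mathcal{F}}$, exit sets $\{x\cup y: x\in\mathbf{\Phi}_{\mathcal{E}},y\in\mathbf{\Phi}_{\mathcal{F}}\}$, and conflict $\#_{\mathcal{E}}\cup\#_{\mathcal{F}}$ together with the symmetric closure of $\mathbf{in}(\mathcal{E})\times\mathbf{in}(\mathcal{F})$ and of all $x\times y$ with $x\in\mathbf{\Phi}_{\mathcal{E}}$, $y\in\mathbf{\Phi}_{\mathcal{F}}$. - $\mathcal{E}\cdot\mathcal{F}$ has events $E\cup F$, conflict $\#_{\mathcal{E}}\cup\#_{\mathcal{F}}$, bundles $\mapsto_{\mathcal{E}}\cup\mapsto_{\mathcal{F}}\cup\{x\mapsto e: x\in\mathbf{\Phi}_{\mathcal{E}},e\in\mathbf{in}(\mathcal{F})\}$, labels $\lambda_{\mathcal{E}}\cup\lambda_{\mathcal{F}}$, exit sets $\mathbf{\Phi}_{\mathcal{F}}$. - $\mathcal{E}\|\mathcal{F}=(E\cup F,\ \mapsto_{\mathcal{E}}\cup\mapsto_{\mathcal{F}},\ \#_{\mathcal{E}}\cup\#_{\mathcal{F}},\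 \lambda_{\mathcal{E}}\cup\lambda_{\mathcal{F}},\ \mathbf{\Phi}_{\mathcal{E}}\cup\mathbf{\Phi}_{\mathcal{F}})$. - $\mathcal{E}*\mathcal{F}$ (binary Kleene star) is the supremum (limit) of the increasing sequence $\mathcal{F},\ \mathcal{F}+\mathcal{E}\cdot\mathcal{F},\ \mathcal{F}+\mathcal{E}\cdot(\mathcal{F}+\mathcal{E}\cdot\mathcal{F}),\dots$. Explicitly, for $\mathcal{E}\ne0$, take disjoint copies $\mathcal{E}_k,\mathcal{F}_k$ ($k\ge0$); the events are those of all copies with their labels; the bundles are those of the copies plus $x\mapsto e$ for $x\in\mathbf{\Phi}_{\mathcal{E}_k}$, $e\in\mathbf{in}(\mathcal{F}_{k+1})\cup\mathbf{in}(\mathcal{E}_{k+1})$; the conflicts are those of the copies plus the symmetric closure of $\mathbf{in}(\mathcal{F}_k)\times\mathbf{in}(\mathcal{E}_k)$ and of $x\times y$ for $x\in\mathbf{\Phi}_{\mathcal{F}_k},y\in\mathbf{\Phi}_{\mathcal{F}_j}$, $j\ne k$; the exit sets are the unions $\bigcup_k x_k$ with $x_k\in\mathbf{\Phi}_{\mathcal{F}_k}$. If $\mathcal{E}=0$ then $\mathcal{E}*\mathcal{F}=\mathcal{F}$.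
   Formalization: The last two implications (for · and ‖) also assume: if the empty trace is maximal in E, it is weakly maximal in F (they fail for E=0). For E≠0 with no exit sets, E*F follows the limit: in(F_k) also conflicts with initial events of all later copies. *)

theory Defs
  imports "HOL-Analysis.Analysis" "HOL-Library.Sublist"
begin

section \<open>Programs\<close>

text \<open>The finite state space is the type \<^typ>\<open>'w::finite\<close>; distributions are vectors in
  \<open>real ^ 'w\<close>, so that convexity and closedness are those of Euclidean space.\<close>

definition distributions :: "(real ^ 'w::finite) set" where
  "distributions = {\<mu>. (\<forall>s. 0 \<le> \<mu> $ s) \<and> (\<Sum>s\<in>UNIV. \<mu> $ s) = 1}"

definition point_dist :: "'w::finite \<Rightarrow> real ^ 'w" where
  "point_dist s = (\<chi> t. if t = s then 1 else 0)"

type_synonym 'w prog = "'w \<Rightarrow> (real ^ 'w) set"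

definition prob_progs :: "('w::finite) prog set" where
  "prob_progs = {r. \<forall>s. r s \<noteq> {} \<and> r s \<subseteq> distributions \<and> convex (r s) \<and> closed (r s)}"

definition tests :: "('w::finite) prog set" where
  "tests = {b. \<forall>s. b s \<subseteq> {point_dist s}}"

definition progs :: "('w::finite) prog set" where
  "progs = prob_progs \<union> tests"

definition prog_le :: "('w::finite) prog \<Rightarrow> 'w prog \<Rightarrow> bool" (infix "\<sqsubseteq>\<^sub>H" 50) where
  "r \<sqsubseteq>\<^sub>H r' \<longleftrightarrow> (\<forall>s. r s \<subseteq> r' s)"

definition skip :: "('w::finite) prog" where
  "skip s = {point_dist s}"


section \<open>Bundle event structures with internal probability\<close>

record ('e, 'w) bes =
  events :: "'e set"
  bundles :: "('e set \<times> 'e) set"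
  conflict :: "('e \<times> 'e) set"
  label :: "'e \<Rightarrow> 'w \<Rightarrow> (real ^ 'w) set"
  exits :: "'e set set"

definition all_conflict :: "('e, 'w::finite) bes \<Rightarrow> 'e set \<Rightarrow> 'e set \<Rightarrow> bool" where
  "all_conflict \<E> x x' \<longleftrightarrow> (\<forall>e\<in>x. \<forall>e'\<in>x'. e \<noteq> e' \<longrightarrow> (e, e') \<in> conflict \<E>)"

definition ipBES :: "('e, 'w::finite) bes \<Rightarrow> bool" where
  "ipBES \<E> \<longleftrightarrow>
     conflict \<E> \<subseteq> events \<E> \<times> events \<E> \<and> irrefl (conflict \<E>) \<and> sym (conflict \<E>) \<and>
     (\<forall>x e. (x, e) \<in> bundles \<E> \<longrightarrow> x \<subseteq> events \<E> \<and> e \<in> events \<E> \<and> all_conflict \<E> x x) \<and>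
     (\<forall>e\<in>events \<E>. label \<E> e \<in> progs) \<and>
     (\<forall>x\<in>exits \<E>. x \<subseteq> events \<E> \<and> all_conflict \<E> x x)"

definition initial :: "('e, 'w::finite) bes \<Rightarrow> 'e set" where
  "initial \<E> = {e \<in> events \<E>. \<nexists>x. (x, e) \<in> bundles \<E>}"

text \<open>For an \<^const>\<open>ipBES\<close>, having no events forces bundles and conflict to be empty.\<close>

definition is_zero :: "('e, 'w::finite) bes \<Rightarrow> bool" where
  "is_zero \<E> \<longleftrightarrow> events \<E> = {} \<and> exits \<E> = {}"


section \<open>Traces and simulations\<close>

definition traces :: "('e, 'w::finite) bes \<Rightarrow> 'e list set" where
  "traces \<E> = {\<alpha>. set \<alpha> \<subseteq> events \<E> \<and> distinct \<alpha> \<and>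
     (\<forall>e\<in>set \<alpha>. \<forall>e'\<in>set \<alpha>. (e, e') \<notin> conflict \<E>) \<and>
     (\<forall>j<length \<alpha>. \<forall>x. (x, \<alpha> ! j) \<in> bundles \<E> \<longrightarrow> (\<exists>i<j. \<alpha> ! i \<in> x))}"

definition max_traces :: "('e, 'w::finite) bes \<Rightarrow> 'e list set" where
  "max_traces \<E> = {\<alpha> \<in> traces \<E>. \<forall>\<beta>\<in>traces \<E>. prefix \<alpha> \<beta> \<longrightarrow> \<beta> = \<alpha>}"

definition weak_max_traces :: "('e, 'w::finite) bes \<Rightarrow> 'e list set" where
  "weak_max_traces \<E> = {\<alpha> \<in> traces \<E>. \<alpha> \<in> max_traces \<E> \<or>
     (\<exists>es. \<alpha> @ es \<in> max_traces \<E> \<and> (\<forall>e\<in>set es. skip \<sqsubseteq>\<^sub>H label \<E> e))}"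

definition t_simulation ::
    "('a, 'w::finite) bes \<Rightarrow> ('b, 'w) bes \<Rightarrow> ('a list \<Rightarrow> 'b list) \<Rightarrow> bool" where
  "t_simulation \<E> \<F> f \<longleftrightarrow>
     (\<forall>\<alpha>\<in>traces \<E>. f \<alpha> \<in> traces \<F>) \<and>
     f [] = [] \<and>
     (\<forall>\<beta>\<in>traces \<F>. finite {\<alpha> \<in> traces \<E>. f \<alpha> = \<beta>}) \<and>
     (\<forall>\<alpha> e. \<alpha> @ [e] \<in> traces \<E> \<longrightarrow>
        f (\<alpha> @ [e]) = f \<alpha> \<and> label \<E> e \<sqsubseteq>\<^sub>H skip \<or>
        (\<exists>e'\<in>events \<F>. label \<E> e \<sqsubseteq>\<^sub>H label \<F> e' \<and> f (\<alpha> @ [e]) = f \<alpha> @ [e'])) \<and>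
     (\<forall>\<alpha> e. \<alpha> @ [e] \<in> max_traces \<E> \<longrightarrow>
        (\<exists>e'\<in>events \<F>. label \<E> e \<sqsubseteq>\<^sub>H label \<F> e' \<and> f (\<alpha> @ [e]) = f \<alpha> @ [e']) \<and>
        f (\<alpha> @ [e]) \<in> weak_max_traces \<F>)"

definition sim_le :: "('a, 'w::finite) bes \<Rightarrow> ('b, 'w) bes \<Rightarrow> bool" (infix "\<sqsubseteq>\<^sub>s\<^sub>i\<^sub>m" 50) where
  "\<E> \<sqsubseteq>\<^sub>s\<^sub>i\<^sub>m \<F> \<longleftrightarrow> (\<exists>f. t_simulation \<E> \<F> f)"

definition sim_eq :: "('a, 'w::finite) bes \<Rightarrow> ('b, 'w) bes \<Rightarrow> bool" (infix "\<equiv>\<^sub>s\<^sub>i\<^sub>m" 50) where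
  "\<E> \<equiv>\<^sub>s\<^sub>i\<^sub>m \<F> \<longleftrightarrow> \<E> \<sqsubseteq>\<^sub>s\<^sub>i\<^sub>m \<F> \<and> \<F> \<sqsubseteq>\<^sub>s\<^sub>i\<^sub>m \<E>"


section \<open>Operations\<close>

definition sym_closure :: "('e \<times> 'e) set \<Rightarrow> ('e \<times> 'e) set" where
  "sym_closure R = R \<union> R\<inverse>"

text \<open>Operands are made disjoint by tagging events with \<^const>\<open>Inl\<close> and \<^const>\<open>Inr\<close>.\<close>

definition bes_par :: "('a, 'w::finite) bes \<Rightarrow> ('b, 'w) bes \<Rightarrow> ('a + 'b, 'w) bes" where
  "bes_par \<E> \<F> = \<lparr>
     events = Inl ` events \<E> \<union> Inr ` events \<F>,
     bundles = {(Inl ` x, Inl e) |x e. (x, e) \<in> bundles \<E>} \<union>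
               {(Inr ` x, Inr e) |x e. (x, e) \<in> bundles \<F>},
     conflict = {(Inl e, Inl e') |e e'. (e, e') \<in> conflict \<E>} \<union>
                {(Inr e, Inr e') |e e'. (e, e') \<in> conflict \<F>},
     label = case_sum (label \<E>) (label \<F>),
     exits = {Inl ` x |x. x \<in> exits \<E>} \<union> {Inr ` x |x. x \<in> exits \<F>}\<rparr>"

text \<open>If one operand is zero, its contribution to \<^const>\<open>bes_par\<close> is empty, so that
  \<^term>\<open>bes_par \<E> \<F>\<close> is just a tagged copy of the other operand. This
  renders the conventions \<open>0 + \<E> = \<E> + 0 = \<E>\<close> and \<open>0 \<cdot> \<E> = \<E> \<cdot> 0 = \<E>\<close>.\<close>

definition bes_plus :: "('a, 'w::finite) bes \<Rightarrow> ('b, 'w) bes \<Rightarrow> ('a + 'b, 'w) bes" where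
  "bes_plus \<E> \<F> =
     (if is_zero \<E> \<or> is_zero \<F> then bes_par \<E> \<F>
      else \<lparr>
        events = Inl ` events \<E> \<union> Inr ` events \<F>,
        bundles = bundles (bes_par \<E> \<F>),
        conflict = conflict (bes_par \<E> \<F>) \<union>
          sym_closure ((Inl ` initial \<E>) \<times> (Inr ` initial \<F>)) \<union>
          sym_closure (\<Union>x\<in>exits \<E>. \<Union>y\<in>exits \<F>. (Inl ` x) \<times> (Inr ` y)),
        label = case_sum (label \<E>) (label \<F>),
        exits = {Inl ` x \<union> Inr ` y |x y. x \<in> exits \<E> \<and> y \<in> exits \<F>}\<rparr>)"

definition bes_seq :: "('a, 'w::finite) bes \<Rightarrow> ('b, 'w) bes \<Rightarrow> ('a + 'b, 'w) bes" where
  "bes_seq \<E> \<F> =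
     (if is_zero \<E> \<or> is_zero \<F> then bes_par \<E> \<F>
      else \<lparr>
        events = Inl ` events \<E> \<union> Inr ` events \<F>,
        bundles = bundles (bes_par \<E> \<F>) \<union>
          {(Inl ` x, Inr e) |x e. x \<in> exits \<E> \<and> e \<in> initial \<F>},
        conflict = conflict (bes_par \<E> \<F>),
        label = case_sum (label \<E>) (label \<F>),
        exits = {Inr ` y |y. y \<in> exits \<F>}\<rparr>)"

text \<open>The binary Kleene star, i.e. the limit of the sequence \<open>\<F>, \<F> + \<E> \<cdot> \<F>, \<F> + \<E> \<cdot> (\<F> + \<E> \<cdot> \<F>), \<dots>\<close>.
  The events \<open>(k, Inl e)\<close> and \<open>(k, Inr f)\<close> are those of the copies \<open>\<E>\<^sub>k\<close> and \<open>\<F>\<^sub>k\<close>.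

  At level \<open>k\<close> the sum puts the initial events of \<open>\<F>\<^sub>k\<close> in conflict with those of
  \<open>\<E>\<^sub>k \<cdot> X\<^sub>k\<^sub>+\<^sub>1\<close>, where \<open>X\<^sub>k\<^sub>+\<^sub>1\<close> collects the copies with index above \<open>k\<close>. If \<open>\<E>\<close> has an
  exit set, these are exactly the initial events of \<open>\<E>\<^sub>k\<close>. If it has none, \<open>\<E>\<^sub>k\<close> guards nothing
  and the initial events of all later copies are initial in \<open>\<E>\<^sub>k \<cdot> X\<^sub>k\<^sub>+\<^sub>1\<close> as well; this is the
  case \<open>exits \<E> = {}\<close> below. In the conflict between exit sets, swapping \<open>k\<close> and \<open>j\<close> gives
  the symmetric closure.\<close>

definition star_conflict ::
    "('a, 'w::finite) bes \<Rightarrow> ('b, 'w) bes \<Rightarrow> ((nat \<times> ('a + 'b)) \<times> (nat \<times> ('a + 'b))) set" where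
  "star_conflict \<E> \<F> =
     {((k, e), (k, e')) |k e e'. (e, e') \<in> conflict (bes_par \<E> \<F>)} \<union>
     sym_closure {((k, Inr f), (k, Inl e)) |k f e. f \<in> initial \<F> \<and> e \<in> initial \<E>} \<union>
     (if exits \<E> = {}
      then sym_closure {((k, Inr f), (j, e)) |k j f e.
             k < j \<and> f \<in> initial \<F> \<and> e \<in> Inl ` initial \<E> \<union> Inr ` initial \<F>}
      else {}) \<union>
     {((k, Inr f), (j, Inr f')) |k j f f'. k \<noteq> j \<and> (\<exists>x\<in>exits \<F>. \<exists>y\<in>exits \<F>. f \<in> x \<and> f' \<in> y)}"

definition bes_star :: "('a, 'w::finite) bes \<Rightarrow> ('b, 'w) bes \<Rightarrow> (nat \<times> ('a + 'b), 'w) bes" where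
  "bes_star \<E> \<F> =
     (if is_zero \<E> then \<comment> \<open>a copy of \<open>\<F>\<close>\<close>
      \<lparr>
        events = {(0, Inr f) |f. f \<in> events \<F>},
        bundles = {((\<lambda>f. (0, Inr f)) ` x, (0, Inr f)) |x f. (x, f) \<in> bundles \<F>},
        conflict = {((0, Inr f), (0, Inr f')) |f f'. (f, f') \<in> conflict \<F>},
        label = case_sum (label \<E>) (label \<F>) \<circ> snd,
        exits = {(\<lambda>f. (0, Inr f)) ` x |x. x \<in> exits \<F>}\<rparr>
      else \<lparr>
        events = {(k, Inl e) |k e. e \<in> events \<E>} \<union> {(k, Inr f) |k f. f \<in> events \<F>},
        bundles =
          {(Pair k ` x, (k, e)) |k x e. (x, e) \<in> bundles (bes_par \<E> \<F>)} \<union>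
          {((\<lambda>e. (k, Inl e)) ` x, (Suc k, e')) |k x e'.
             x \<in> exits \<E> \<and> e' \<in> Inr ` initial \<F> \<union> Inl ` initial \<E>},
        conflict = star_conflict \<E> \<F>,
        label = case_sum (label \<E>) (label \<F>) \<circ> snd,
        exits = {(\<Union>k. (\<lambda>f. (k, Inr f)) ` x k) |x. \<forall>k. x k \<in> exits \<F>}\<rparr>)"

end

theory Submission
  imports Defs
begin

text \<open>All the notions involved depend only on the traces and their labels, so the work is to describe
  the traces of each operation. A trace of a sum is a trace of one of the summands, and the
  traces of parallel and sequential compositions are interleavings subject to a guard, so that a
  t-simulation of the right operand lifts to the composition. Commutativity, associativity and
  the unfolding of the star are renamings of events, except that for \<open>\<E> = 0\<close> the unfolding reads
  \<open>\<F> \<equiv> \<F> + \<F>\<close>, where folding the two summands gives the nontrivial simulation.\<close>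

section \<open>Traces\<close>

text \<open>The condition on \<open>[]\<close> in the last two implications answers a gap in clause
  (iii) of t-simulation, which speaks of traces \<open>\<alpha> @ [e]\<close> only. If
  \<open>[]\<close> is the sole trace of \<open>\<E>\<close>, as for \<open>\<E> = 0\<close>, then
  \<open>f [] = []\<close> already simulates \<open>\<E>\<close> by every \<open>\<F>\<close>. Let
  \<open>\<G>\<close> have one event, which forms its exit set, and let \<open>\<F>\<close> have one
  event, with neither label above \<open>skip\<close>. All maximal traces of
  \<open>\<G> \<cdot> \<F>\<close> and of \<open>\<F> \<parallel> \<G>\<close> use both events. The
  one-event maximal trace of \<open>\<G>\<close> must be mapped to a trace of length one, which is
  then not weakly maximal. In general, a nonempty maximal trace of a composition may have an empty
  part in \<open>\<E>\<close>, and the condition serves exactly these traces. In a sum, a nonempty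
  trace lies in one summand, so clause (iii) speaks about it directly.\<close>

lemma Nil_in_traces [simp]: "[] \<in> traces \<E>"
  by (simp add: traces_def)

text \<open>Adding one event turns the conditions on indices into conditions on sets, which makes
  reverse induction on traces workable. Conflict is tested in both orders, and for \<open>e\<close>
  against itself, because \<open>traces_def\<close> quantifies over all ordered pairs of
  entries.\<close>

lemma traces_snoc:
  "\<alpha> @ [e] \<in> traces \<E> \<longleftrightarrow> \<alpha> \<in> traces \<E> \<and> e \<in> events \<E> \<and> e \<notin> set \<alpha> \<and>
     (\<forall>e'\<in>insert e (set \<alpha>). (e, e') \<notin> conflict \<E> \<and> (e', e) \<notin> conflict \<E>) \<and>
     (\<forall>x. (x, e) \<in> bundles \<E> \<longrightarrow> set \<alpha> \<inter> x \<noteq> {})"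
proof -
  have hit: "(\<exists>i<length \<alpha>. \<alpha> ! i \<in> x) \<longleftrightarrow> set \<alpha> \<inter> x \<noteq> {}" for x
    by (auto simp: in_set_conv_nth disjoint_iff)
  have pre: "(\<exists>i<j. (\<alpha> @ [e]) ! i \<in> x) \<longleftrightarrow> (\<exists>i<j. \<alpha> ! i \<in> x)" if "j \<le> length \<alpha>" for j x
    using that by (metis less_le_trans nth_append)
  have bnd: "(\<forall>j<length (\<alpha> @ [e]). \<forall>x. (x, (\<alpha> @ [e]) ! j) \<in> bundles \<E> \<longrightarrow> (\<exists>i<j. (\<alpha> @ [e]) ! i \<in> x))
    \<longleftrightarrow> (\<forall>j<length \<alpha>. \<forall>x. (x, \<alpha> ! j) \<in> bundles \<E> \<longrightarrow> (\<exists>i<j. \<alpha> ! i \<in> x)) \<and>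
        (\<forall>x. (x, e) \<in> bundles \<E> \<longrightarrow> (\<exists>i<length \<alpha>. \<alpha> ! i \<in> x))"
    by (simp add: less_Suc_eq pre nth_append_left imp_disjL all_conj_distrib cong: conj_cong)
  show ?thesis
    unfolding traces_def mem_Collect_eq bnd hit by auto
qed

lemma traces_append: "\<alpha> @ \<beta> \<in> traces \<E> \<Longrightarrow> \<alpha> \<in> traces \<E>"
  by (induction \<beta> rule: rev_induct) (simp_all add: traces_snoc flip: append_assoc)

lemma set_traces: "\<alpha> \<in> traces \<E> \<Longrightarrow> e \<in> set \<alpha> \<Longrightarrow> e \<in> events \<E>"
  by (auto simp: traces_def)

text \<open>Traces are prefix-closed, so any proper extension already yields a one-event
  extension.\<close>

lemma max_traces_iff: "\<alpha> \<in> max_traces \<E> \<longleftrightarrow> \<alpha> \<in> traces \<E> \<and> (\<forall>e. \<alpha> @ [e] \<notin> traces \<E>)"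
proof
  assume \<alpha>: "\<alpha> \<in> max_traces \<E>"
  have "\<alpha> @ [e] \<notin> traces \<E>" for e
  proof
    assume "\<alpha> @ [e] \<in> traces \<E>"
    moreover have "prefix \<alpha> (\<alpha> @ [e])"
      by simp
    ultimately have "\<alpha> @ [e] = \<alpha>"
      using \<alpha> unfolding max_traces_def by blast
    then show False
      by simp
  qed
  then show "\<alpha> \<in> traces \<E> \<and> (\<forall>e. \<alpha> @ [e] \<notin> traces \<E>)"
    using \<alpha> by (simp add: max_traces_def)
next
  assume \<alpha>: "\<alpha> \<in> traces \<E> \<and> (\<forall>e. \<alpha> @ [e] \<notin> traces \<E>)"
  have "\<beta> = \<alpha>" if "prefix \<alpha> \<beta>" "\<beta> \<in> traces \<E>" for \<beta>
  proof -
    obtain \<gamma> where \<gamma>: "\<beta> = \<alpha> @ \<gamma>"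
      using \<open>prefix \<alpha> \<beta>\<close> by (rule prefixE)
    show ?thesis
    proof (cases \<gamma>)
      case (Cons e \<delta>)
      then have "(\<alpha> @ [e]) @ \<delta> \<in> traces \<E>"
        using that \<gamma> by simp
      then show ?thesis
        using \<alpha> traces_append by blast
    qed (use \<gamma> in simp)
  qed
  then show "\<alpha> \<in> max_traces \<E>"
    unfolding max_traces_def using \<alpha> by blast
qed

text \<open>Taking \<open>es = []\<close> covers the maximal case, so that later proofs handle a
  single form of weak maximality.\<close>

lemma weak_max_tracesI:
  assumes "\<alpha> @ es \<in> max_traces \<E>" and "\<And>e. e \<in> set es \<Longrightarrow> skip \<sqsubseteq>\<^sub>H label \<E> e"
  shows "\<alpha> \<in> weak_max_traces \<E>"
proof -
  have "\<alpha> \<in> traces \<E>"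
    using assms(1) traces_append unfolding max_traces_iff by blast
  then show ?thesis
    unfolding weak_max_traces_def using assms by blast
qed

lemma weak_max_tracesE:
  assumes "\<alpha> \<in> weak_max_traces \<E>"
  obtains es where "\<alpha> @ es \<in> max_traces \<E>" and "\<forall>e\<in>set es. skip \<sqsubseteq>\<^sub>H label \<E> e"
proof -
  consider "\<alpha> \<in> max_traces \<E>" |
    es where "\<alpha> @ es \<in> max_traces \<E>" "\<forall>e\<in>set es. skip \<sqsubseteq>\<^sub>H label \<E> e"
    using assms unfolding weak_max_traces_def by blast
  then show ?thesis
  proof cases
    case 1
    then show ?thesis
      using that[of "[]"] by simp
  next
    case 2
    then show ?thesis
      using that by blast
  qed
qed

lemma t_simulationI:
  assumes "\<And>\<alpha>. \<alpha> \<in> traces \<E> \<Longrightarrow> f \<alpha> \<in> traces \<F>" and "f [] = []"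
    and "\<And>\<beta>. \<beta> \<in> traces \<F> \<Longrightarrow> finite {\<alpha> \<in> traces \<E>. f \<alpha> = \<beta>}"
    and "\<And>\<alpha> e. \<alpha> @ [e] \<in> traces \<E> \<Longrightarrow> f (\<alpha> @ [e]) = f \<alpha> \<and> label \<E> e \<sqsubseteq>\<^sub>H skip \<or>
      (\<exists>e'\<in>events \<F>. label \<E> e \<sqsubseteq>\<^sub>H label \<F> e' \<and> f (\<alpha> @ [e]) = f \<alpha> @ [e'])"
    and "\<And>\<alpha> e. \<alpha> @ [e] \<in> max_traces \<E> \<Longrightarrow>
      (\<exists>e'\<in>events \<F>. label \<E> e \<sqsubseteq>\<^sub>H label \<F> e' \<and> f (\<alpha> @ [e]) = f \<alpha> @ [e']) \<and>
      f (\<alpha> @ [e]) \<in> weak_max_traces \<F>"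
  shows "t_simulation \<E> \<F> f"
  unfolding t_simulation_def by (intro conjI ballI allI impI assms)

text \<open>Finite fibres of \<open>p\<close> take the place of injectivity: a preimage of a trace
  has the same length, and its entries lie in finitely many fibres. This leaves room for folding two
  copies of a structure onto one. Maximality is asked of nonempty traces only, as in clause
  (iii).\<close>

lemma t_simulation_map:
  assumes tr: "\<And>\<alpha>. \<alpha> \<in> traces \<E> \<Longrightarrow> map p \<alpha> \<in> traces \<F>"
    and mx: "\<And>\<alpha>. \<alpha> \<in> max_traces \<E> \<Longrightarrow> \<alpha> \<noteq> [] \<Longrightarrow> map p \<alpha> \<in> max_traces \<F>"
    and lab: "\<And>e. e \<in> events \<E> \<Longrightarrow> label \<F> (p e) = label \<E> e"
    and fin: "\<And>e'. finite {e \<in> events \<E>. p e = e'}"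
  shows "t_simulation \<E> \<F> (map p)"
proof -
  have "finite {\<alpha> \<in> traces \<E>. map p \<alpha> = \<beta>}" for \<beta>
  proof (rule finite_subset)
    let ?A = "\<Union>e'\<in>set \<beta>. {e \<in> events \<E>. p e = e'}"
    show "{\<alpha> \<in> traces \<E>. map p \<alpha> = \<beta>} \<subseteq> {\<alpha>. set \<alpha> \<subseteq> ?A \<and> length \<alpha> = length \<beta>}"
      by (auto dest: set_traces)
    show "finite {\<alpha>. set \<alpha> \<subseteq> ?A \<and> length \<alpha> = length \<beta>}"
      by (intro finite_lists_length_eq) (auto intro: fin)
  qed
  moreover have "\<exists>e'\<in>events \<F>. label \<E> e \<sqsubseteq>\<^sub>H label \<F> e' \<and> map p (\<alpha> @ [e]) = map p \<alpha> @ [e']"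
    if "\<alpha> @ [e] \<in> traces \<E>" for \<alpha> e
    using tr[OF that] lab[of e] set_traces[OF that, of e]
    by (auto intro!: bexI[of _ "p e"] simp: prog_le_def traces_snoc)
  moreover have "map p \<alpha> \<in> weak_max_traces \<F>" if "\<alpha> \<in> max_traces \<E>" "\<alpha> \<noteq> []" for \<alpha>
    using mx[OF that] by (intro weak_max_tracesI[of _ "[]"]) auto
  ultimately show ?thesis
    using tr by (intro t_simulationI) (auto simp: max_traces_iff simp del: map_append)
qed


section \<open>Renaming events\<close>

text \<open>Only what a simulation can observe is compared. Injectivity on the whole type lets
  \<open>inv h\<close> undo \<open>map h\<close> without side conditions.\<close>

definition trace_iso ::
    "('a \<Rightarrow> 'b) \<Rightarrow> ('a, 'w::finite) bes \<Rightarrow> ('b, 'w) bes \<Rightarrow> bool" where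
  "trace_iso h \<E> \<F> \<longleftrightarrow> inj h \<and> events \<F> = h ` events \<E> \<and> traces \<F> = map h ` traces \<E> \<and>
     (\<forall>e\<in>events \<E>. label \<F> (h e) = label \<E> e)"

lemma trace_iso_id: "trace_iso id \<E> \<E>"
  by (simp add: trace_iso_def)

lemma map_in_traces_iff: "trace_iso h \<E> \<F> \<Longrightarrow> map h \<alpha> \<in> traces \<F> \<longleftrightarrow> \<alpha> \<in> traces \<E>"
  by (auto simp: trace_iso_def inj_map_eq_map image_iff)

lemma trace_iso_snoc:
  assumes "trace_iso h \<E> \<F>" and "map h \<alpha> @ [e'] \<in> traces \<F>"
  obtains e where "e' = h e" and "\<alpha> @ [e] \<in> traces \<E>"
proof -
  obtain \<beta> where "\<beta> \<in> traces \<E>" "map h \<alpha> @ [e'] = map h \<beta>"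
    using assms by (auto simp: trace_iso_def)
  moreover then obtain \<gamma> e where "\<beta> = \<gamma> @ [e]"
    by (cases \<beta> rule: rev_cases) auto
  ultimately show ?thesis
    using that[of e] assms(1) by (auto simp: trace_iso_def inj_map_eq_map)
qed

lemma map_in_max_traces_iff:
  assumes iso: "trace_iso h \<E> \<F>"
  shows "map h \<alpha> \<in> max_traces \<F> \<longleftrightarrow> \<alpha> \<in> max_traces \<E>"
proof -
  have "(\<exists>e'. map h \<alpha> @ [e'] \<in> traces \<F>) \<longleftrightarrow> (\<exists>e. \<alpha> @ [e] \<in> traces \<E>)"
  proof
    assume "\<exists>e'. map h \<alpha> @ [e'] \<in> traces \<F>"
    then obtain e' where "map h \<alpha> @ [e'] \<in> traces \<F>" ..
    then show "\<exists>e. \<alpha> @ [e] \<in> traces \<E>"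
      by (rule trace_iso_snoc[OF iso]) blast
  next
    assume "\<exists>e. \<alpha> @ [e] \<in> traces \<E>"
    then obtain e where "\<alpha> @ [e] \<in> traces \<E>" ..
    then have "map h \<alpha> @ [h e] \<in> traces \<F>"
      using map_in_traces_iff[OF iso, of "\<alpha> @ [e]"] by simp
    then show "\<exists>e'. map h \<alpha> @ [e'] \<in> traces \<F>" ..
  qed
  then show ?thesis
    unfolding max_traces_iff map_in_traces_iff[OF iso] by blast
qed

lemma map_in_weak_max_traces:
  assumes iso: "trace_iso h \<E> \<F>" and "\<alpha> \<in> weak_max_traces \<E>"
  shows "map h \<alpha> \<in> weak_max_traces \<F>"
proof -
  obtain es where es: "\<alpha> @ es \<in> max_traces \<E>" "\<forall>e\<in>set es. skip \<sqsubseteq>\<^sub>H label \<E> e"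
    using assms(2) by (rule weak_max_tracesE)
  show ?thesis
  proof (rule weak_max_tracesI)
    show "map h \<alpha> @ map h es \<in> max_traces \<F>"
      using es(1) map_in_max_traces_iff[OF iso, of "\<alpha> @ es"] by simp
    have "e \<in> events \<E>" if "e \<in> set es" for e
      using that es(1) set_traces[of "\<alpha> @ es" \<E>] by (simp add: max_traces_iff)
    then show "skip \<sqsubseteq>\<^sub>H label \<F> e'" if "e' \<in> set (map h es)" for e'
      using that es(2) iso by (auto simp: trace_iso_def)
  qed
qed

text \<open>\<^const>\<open>sim_le\<close> need not be transitive: a maximal trace may be mapped to one that is only
  weakly maximal, whose last event a further simulation may delete. Composition with
  renamings is harmless.\<close>

lemma sim_le_trace_iso:
  assumes h: "trace_iso h \<E> \<E>'" and k: "trace_iso k \<F> \<F>'" and "\<E> \<sqsubseteq>\<^sub>s\<^sub>i\<^sub>m \<F>"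
  shows "\<E>' \<sqsubseteq>\<^sub>s\<^sub>i\<^sub>m \<F>'"
proof -
  obtain f where f: "t_simulation \<E> \<F> f"
    using assms(3) by (auto simp: sim_le_def)
  define g where "g = (\<lambda>\<alpha>. map k (f (map (inv h) \<alpha>)))"
  have inv: "inv h \<circ> h = id" and kinj: "inj k"
    using h k by (auto simp: trace_iso_def)
  have g_map: "g (map h \<alpha>) = map k (f \<alpha>)" for \<alpha>
    by (simp add: g_def inv)
  have T: "traces \<E>' = map h ` traces \<E>"
    using h by (simp add: trace_iso_def)
  have lab: "label \<E>' (h e) = label \<E> e" if "e \<in> events \<E>" for e
    using h that by (simp add: trace_iso_def)
  have labk: "label \<F>' (k e) = label \<F> e" "k e \<in> events \<F>'" if "e \<in> events \<F>" for e
    using k that by (simp_all add: trace_iso_def)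
  have snocE: "\<exists>\<beta> e. \<alpha> = map h \<beta> \<and> e' = h e \<and> \<beta> @ [e] \<in> traces \<E> \<and> e \<in> events \<E>"
    if tr: "\<alpha> @ [e'] \<in> traces \<E>'" for \<alpha> e'
  proof -
    have "\<alpha> \<in> traces \<E>'"
      using tr traces_append by blast
    then obtain \<beta> where \<beta>: "\<alpha> = map h \<beta>"
      using T by auto
    obtain e where "e' = h e" "\<beta> @ [e] \<in> traces \<E>"
      by (rule trace_iso_snoc[OF h, of \<beta> e']) (use tr \<beta> in auto)
    then show ?thesis
      using \<beta> by (auto simp: traces_snoc)
  qed
  have "g \<alpha> \<in> traces \<F>'" if "\<alpha> \<in> traces \<E>'" for \<alpha>
    using that f k by (auto simp: T g_map t_simulation_def map_in_traces_iff)
  moreover have "g [] = []"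
    using f by (simp add: g_def t_simulation_def)
  moreover have "finite {\<alpha> \<in> traces \<E>'. g \<alpha> = \<beta>}" if \<beta>: "\<beta> \<in> traces \<F>'" for \<beta>
  proof -
    obtain \<gamma> where \<gamma>: "\<beta> = map k \<gamma>" "\<gamma> \<in> traces \<F>"
      using \<beta> k by (auto simp: trace_iso_def)
    then have "{\<alpha> \<in> traces \<E>'. g \<alpha> = \<beta>} = map h ` {\<alpha> \<in> traces \<E>. f \<alpha> = \<gamma>}"
      using kinj by (auto simp: T g_map inj_map_eq_map)
    then show ?thesis
      using f \<gamma>(2) by (simp add: t_simulation_def)
  qed
  moreover have "g (\<alpha> @ [e]) = g \<alpha> \<and> label \<E>' e \<sqsubseteq>\<^sub>H skip \<or>
      (\<exists>e'\<in>events \<F>'. label \<E>' e \<sqsubseteq>\<^sub>H label \<F>' e' \<and> g (\<alpha> @ [e]) = g \<alpha> @ [e'])"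
    if tr: "\<alpha> @ [e] \<in> traces \<E>'" for \<alpha> e
  proof -
    obtain \<beta> d where \<beta>: "\<alpha> = map h \<beta>" "e = h d" "\<beta> @ [d] \<in> traces \<E>" "d \<in> events \<E>"
      using snocE[OF tr] by blast
    then have "g (\<alpha> @ [e]) = map k (f (\<beta> @ [d]))" "g \<alpha> = map k (f \<beta>)"
      using g_map[of "\<beta> @ [d]"] g_map[of \<beta>] by simp_all
    moreover have "f (\<beta> @ [d]) = f \<beta> \<and> label \<E> d \<sqsubseteq>\<^sub>H skip \<or>
        (\<exists>e'\<in>events \<F>. label \<E> d \<sqsubseteq>\<^sub>H label \<F> e' \<and> f (\<beta> @ [d]) = f \<beta> @ [e'])"
      using f \<beta>(3) by (simp add: t_simulation_def)
    ultimately show ?thesis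
      unfolding \<beta>(2) lab[OF \<beta>(4)] by (auto simp: labk)
  qed
  moreover have "(\<exists>e'\<in>events \<F>'. label \<E>' e \<sqsubseteq>\<^sub>H label \<F>' e' \<and> g (\<alpha> @ [e]) = g \<alpha> @ [e']) \<and>
      g (\<alpha> @ [e]) \<in> weak_max_traces \<F>'"
    if mx: "\<alpha> @ [e] \<in> max_traces \<E>'" for \<alpha> e
  proof -
    obtain \<beta> d where \<beta>: "\<alpha> = map h \<beta>" "e = h d" "\<beta> @ [d] \<in> traces \<E>" "d \<in> events \<E>"
      using snocE[of \<alpha> e] mx by (auto simp: max_traces_iff)
    then have g: "g (\<alpha> @ [e]) = map k (f (\<beta> @ [d]))" "g \<alpha> = map k (f \<beta>)"
      using g_map[of "\<beta> @ [d]"] g_map[of \<beta>] by simp_all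
    have "\<beta> @ [d] \<in> max_traces \<E>"
      using mx \<beta>(1,2) map_in_max_traces_iff[OF h, of "\<beta> @ [d]"] by simp
    then have "(\<exists>e'\<in>events \<F>. label \<E> d \<sqsubseteq>\<^sub>H label \<F> e' \<and> f (\<beta> @ [d]) = f \<beta> @ [e']) \<and>
        f (\<beta> @ [d]) \<in> weak_max_traces \<F>"
      using f by (simp add: t_simulation_def)
    then show ?thesis
      unfolding g unfolding \<beta>(2) lab[OF \<beta>(4)] by (auto simp: labk map_in_weak_max_traces[OF k])
  qed
  ultimately have "t_simulation \<E>' \<F>' g"
    by (rule t_simulationI)
  then show ?thesis
    by (auto simp: sim_le_def)
qed

lemma sim_le_refl: "\<E> \<sqsubseteq>\<^sub>s\<^sub>i\<^sub>m \<E>"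
proof -
  have "t_simulation \<E> \<E> (map id)"
    by (rule t_simulation_map) auto
  then show ?thesis
    by (auto simp: sim_le_def)
qed

lemma trace_iso_sim_eq: "trace_iso h \<E> \<F> \<Longrightarrow> \<E> \<equiv>\<^sub>s\<^sub>i\<^sub>m \<F>"
  unfolding sim_eq_def
  using sim_le_trace_iso[OF trace_iso_id _ sim_le_refl] sim_le_trace_iso[OF _ trace_iso_id sim_le_refl]
  by blast

text \<open>A trace tests conflict and bundles only at its own entries, so agreement on events is
  enough. Bundles are compared as the set of guards of one event, the form in which they are
  computed for each operation below.\<close>

lemma trace_isoI:
  assumes "inj h" and ev: "events \<F> = h ` events \<E>"
    and con: "\<And>a b. a \<in> events \<E> \<Longrightarrow> b \<in> events \<E> \<Longrightarrow>
      (h a, h b) \<in> conflict \<F> \<longleftrightarrow> (a, b) \<in> conflict \<E>"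
    and bun: "\<And>a. a \<in> events \<E> \<Longrightarrow>
      {x. (x, h a) \<in> bundles \<F>} = (`) h ` {x. (x, a) \<in> bundles \<E>}"
    and lab: "\<And>e. e \<in> events \<E> \<Longrightarrow> label \<F> (h e) = label \<E> e"
  shows "trace_iso h \<E> \<F>"
proof -
  have iff: "map h \<alpha> \<in> traces \<F> \<longleftrightarrow> \<alpha> \<in> traces \<E>" for \<alpha>
  proof (induction \<alpha> rule: rev_induct)
    case (snoc a \<alpha>)
    show ?case
    proof (cases "\<alpha> \<in> traces \<E> \<and> a \<in> events \<E>")
      case True
      then have \<alpha>: "e \<in> events \<E>" if "e \<in> insert a (set \<alpha>)" for e
        using that by (auto dest: set_traces)
      \<comment> \<open>The bounded quantifier exposes the set that \<open>bun\<close> rewrites;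
        injectivity then cancels \<open>h\<close> in the intersections.\<close>
      have "(\<forall>x. (x, h a) \<in> bundles \<F> \<longrightarrow> h ` set \<alpha> \<inter> x \<noteq> {}) \<longleftrightarrow>
          (\<forall>x\<in>{x. (x, h a) \<in> bundles \<F>}. h ` set \<alpha> \<inter> x \<noteq> {})"
        by simp
      also have "\<dots> \<longleftrightarrow> (\<forall>x. (x, a) \<in> bundles \<E> \<longrightarrow> set \<alpha> \<inter> x \<noteq> {})"
        using True \<open>inj h\<close> by (simp add: bun flip: image_Int)
      finally have b: "(\<forall>x. (x, h a) \<in> bundles \<F> \<longrightarrow> h ` set \<alpha> \<inter> x \<noteq> {}) \<longleftrightarrow>
          (\<forall>x. (x, a) \<in> bundles \<E> \<longrightarrow> set \<alpha> \<inter> x \<noteq> {})" .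
      have "(\<forall>e'\<in>insert (h a) (h ` set \<alpha>). (h a, e') \<notin> conflict \<F> \<and> (e', h a) \<notin> conflict \<F>) \<longleftrightarrow>
          (\<forall>e'\<in>insert a (set \<alpha>). (a, e') \<notin> conflict \<E> \<and> (e', a) \<notin> conflict \<E>)"
        using \<alpha> con by auto
      with b show ?thesis
        using True snoc ev \<open>inj h\<close> by (simp add: traces_snoc inj_image_mem_iff)
    qed (use snoc ev \<open>inj h\<close> in \<open>auto simp: traces_snoc inj_image_mem_iff\<close>)
  qed simp
  have "traces \<F> \<subseteq> map h ` traces \<E>"
  proof
    fix \<beta> assume \<beta>: "\<beta> \<in> traces \<F>"
    then have "set \<beta> \<subseteq> range h"
      using ev by (fastforce dest: set_traces)
    then obtain \<alpha> where "\<beta> = map h \<alpha>"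
      by (metis ex_map_conv rangeE subsetD)
    then show "\<beta> \<in> map h ` traces \<E>"
      using \<beta> iff by auto
  qed
  then show ?thesis
    using assms iff by (auto simp: trace_iso_def)
qed


section \<open>Parallel composition, sequencing and sums\<close>

definition lefts :: "('a + 'b) list \<Rightarrow> 'a list" where
  "lefts \<alpha> = concat (map (case_sum (\<lambda>a. [a]) (\<lambda>_. [])) \<alpha>)"

definition rights :: "('a + 'b) list \<Rightarrow> 'b list" where
  "rights \<alpha> = concat (map (case_sum (\<lambda>_. []) (\<lambda>b. [b])) \<alpha>)"

lemma lefts_simps [simp]:
  "lefts [] = []" "lefts (\<alpha> @ \<beta>) = lefts \<alpha> @ lefts \<beta>"
  "lefts (Inl a # \<alpha>) = a # lefts \<alpha>" "lefts (Inr b # \<alpha>) = lefts \<alpha>"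
  by (simp_all add: lefts_def)

lemma rights_simps [simp]:
  "rights [] = []" "rights (\<alpha> @ \<beta>) = rights \<alpha> @ rights \<beta>"
  "rights (Inl a # \<alpha>) = rights \<alpha>" "rights (Inr b # \<alpha>) = b # rights \<alpha>"
  by (simp_all add: rights_def)

lemma lefts_map_Inr [simp]: "lefts (map Inr es) = []" and
  rights_map_Inr [simp]: "rights (map Inr es) = es"
  by (induction es) simp_all

lemma in_set_lefts [simp]: "a \<in> set (lefts \<alpha>) \<longleftrightarrow> Inl a \<in> set \<alpha>" and
  in_set_rights [simp]: "b \<in> set (rights \<alpha>) \<longleftrightarrow> Inr b \<in> set \<alpha>"
  by (auto simp: lefts_def rights_def split: sum.splits)

lemma length_lefts_rights: "length \<alpha> = length (lefts \<alpha>) + length (rights \<alpha>)"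
proof (induction \<alpha>)
  case (Cons a \<alpha>)
  then show ?case
    by (cases a) simp_all
qed simp

text \<open>The two projections determine the entries and, by \<open>length_lefts_rights\<close>,
  the length. This supplies the finite fibres when one operand of a composition is
  simulated.\<close>

lemma finite_interleavings: "finite {\<alpha>. lefts \<alpha> = as \<and> rights \<alpha> = bs}"
proof (rule finite_subset)
  let ?A = "Inl ` set as \<union> Inr ` set bs"
  show "{\<alpha>. lefts \<alpha> = as \<and> rights \<alpha> = bs} \<subseteq>
      {\<alpha>. set \<alpha> \<subseteq> ?A \<and> length \<alpha> = length as + length bs}"
  proof safe
    fix \<alpha> :: "('a + 'b) list" and x
    assume x: "x \<in> set \<alpha>" "x \<notin> Inr ` set (rights \<alpha>)"
    show "x \<in> Inl ` set (lefts \<alpha>)"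
    proof (cases x)
      case (Inl a)
      then show ?thesis
        using x by (simp add: image_iff)
    next
      case (Inr b)
      then show ?thesis
        using x by (simp add: image_iff)
    qed
  qed (rule length_lefts_rights)
  show "finite {\<alpha>. set \<alpha> \<subseteq> ?A \<and> length \<alpha> = length as + length bs}"
    by (rule finite_lists_length_eq) simp
qed

text \<open>The traces of both \<^const>\<open>bes_par\<close> (with \<open>\<Phi> = {}\<close>) and \<^const>\<open>bes_seq\<close> (with
  \<open>\<Phi> = exits \<E>\<close>, including the cases where an operand is zero) are the interleavings in
  which every event of the right operand is preceded by a hit of each set in \<open>\<Phi>\<close>.\<close>

definition ready :: "'a set set \<Rightarrow> ('a + 'b) list \<Rightarrow> bool" where
  "ready \<Phi> \<alpha> \<longleftrightarrow> (\<forall>x\<in>\<Phi>. \<exists>a\<in>x. Inl a \<in> set \<alpha>)"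

definition guarded :: "'a set set \<Rightarrow> ('a + 'b) list \<Rightarrow> bool" where
  "guarded \<Phi> \<alpha> \<longleftrightarrow> (\<forall>\<beta> b. prefix (\<beta> @ [Inr b]) \<alpha> \<longrightarrow> ready \<Phi> \<beta>)"

definition interleavings ::
    "'a set set \<Rightarrow> ('a, 'w::finite) bes \<Rightarrow> ('b, 'w) bes \<Rightarrow> ('a + 'b) list set" where
  "interleavings \<Phi> \<E> \<F> = {\<alpha>. lefts \<alpha> \<in> traces \<E> \<and> rights \<alpha> \<in> traces \<F> \<and> guarded \<Phi> \<alpha>}"

lemma ready_mono: "ready \<Phi> \<alpha> \<Longrightarrow> set \<alpha> \<subseteq> set \<beta> \<Longrightarrow> ready \<Phi> \<beta>"
  unfolding ready_def by blast

lemma guarded_simps [simp]: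
  "guarded \<Phi> []" "guarded \<Phi> (\<alpha> @ [Inl a]) \<longleftrightarrow> guarded \<Phi> \<alpha>"
  "guarded \<Phi> (\<alpha> @ [Inr b]) \<longleftrightarrow> guarded \<Phi> \<alpha> \<and> ready \<Phi> \<alpha>"
  by (auto simp: guarded_def)

text \<open>The first right event required a hit of every set in \<open>\<Phi>\<close>, and hits
  persist. One right event therefore unlocks the right operand for good.\<close>

lemma guarded_ready:
  assumes "guarded \<Phi> \<alpha>" and "rights \<alpha> \<noteq> []"
  shows "ready \<Phi> \<alpha>"
  using assms
proof (induction \<alpha> rule: rev_induct)
  case (snoc a \<alpha>)
  then have "ready \<Phi> \<alpha>"
    by (cases a) auto
  then show ?case
    by (rule ready_mono) auto
qed simp

lemma guarded_empty: "guarded {} \<alpha>"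
  by (simp add: guarded_def ready_def)

lemma guarded_append_Inr: "guarded \<Phi> \<alpha> \<Longrightarrow> ready \<Phi> \<alpha> \<Longrightarrow> guarded \<Phi> (\<alpha> @ map Inr es)"
proof (induction es rule: rev_induct)
  case (snoc e es)
  have "ready \<Phi> (\<alpha> @ map Inr es)"
    using snoc.prems(2) by (rule ready_mono) simp
  then have "guarded \<Phi> ((\<alpha> @ map Inr es) @ [Inr e])"
    unfolding guarded_simps using snoc by simp
  then show ?case
    by simp
qed simp

section \<open>Trace sets of parallel composition, sequencing and sums\<close>

lemma traces_par: "traces (bes_par \<E> \<F>) = interleavings {} \<E> \<F>"
proof -
  have "\<alpha> \<in> traces (bes_par \<E> \<F>) \<longleftrightarrow> \<alpha> \<in> interleavings {} \<E> \<F>" for \<alpha>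
  proof (induction \<alpha> rule: rev_induct)
    case (snoc a \<alpha>)
    have inl: "set \<alpha> \<inter> Inl ` x \<noteq> {} \<longleftrightarrow> set (lefts \<alpha>) \<inter> x \<noteq> {}" for x
      by auto
    have inr: "set \<alpha> \<inter> Inr ` x \<noteq> {} \<longleftrightarrow> set (rights \<alpha>) \<inter> x \<noteq> {}" for x
      by auto
    show ?case
    proof (cases a)
      case (Inl e)
      have b: "(\<forall>x. (x, a) \<in> bundles (bes_par \<E> \<F>) \<longrightarrow> set \<alpha> \<inter> x \<noteq> {}) \<longleftrightarrow>
          (\<forall>x. (x, e) \<in> bundles \<E> \<longrightarrow> set (lefts \<alpha>) \<inter> x \<noteq> {})"
        unfolding inl[symmetric] by (auto simp: bes_par_def Inl)
      have c: "(\<forall>e'\<in>insert a (set \<alpha>). (a, e') \<notin> conflict (bes_par \<E> \<F>) \<and> (e', a) \<notin> conflict (bes_par \<E> \<F>))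
        \<longleftrightarrow> (\<forall>e'\<in>insert e (set (lefts \<alpha>)). (e, e') \<notin> conflict \<E> \<and> (e', e) \<notin> conflict \<E>)"
        by (auto simp: bes_par_def Inl)
      show ?thesis
        unfolding traces_snoc b c snoc
        by (auto simp: interleavings_def guarded_empty traces_snoc Inl) (auto simp: bes_par_def)
    next
      case (Inr e)
      have b: "(\<forall>x. (x, a) \<in> bundles (bes_par \<E> \<F>) \<longrightarrow> set \<alpha> \<inter> x \<noteq> {}) \<longleftrightarrow>
          (\<forall>x. (x, e) \<in> bundles \<F> \<longrightarrow> set (rights \<alpha>) \<inter> x \<noteq> {})"
        unfolding inr[symmetric] by (auto simp: bes_par_def Inr)
      have c: "(\<forall>e'\<in>insert a (set \<alpha>). (a, e') \<notin> conflict (bes_par \<E> \<F>) \<and> (e', a) \<notin> conflict (bes_par \<E> \<F>))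
        \<longleftrightarrow> (\<forall>e'\<in>insert e (set (rights \<alpha>)). (e, e') \<notin> conflict \<F> \<and> (e', e) \<notin> conflict \<F>)"
        by (auto simp: bes_par_def Inr)
      show ?thesis
        unfolding traces_snoc b c snoc
        by (auto simp: interleavings_def guarded_empty traces_snoc Inr) (auto simp: bes_par_def)
    qed
  qed (simp add: interleavings_def)
  then show ?thesis
    by blast
qed

lemma label_operations [simp]:
  "label (bes_par \<E> \<F>) = case_sum (label \<E>) (label \<F>)"
  "label (bes_seq \<E> \<F>) = case_sum (label \<E>) (label \<F>)"
  "label (bes_plus \<E> \<F>) = case_sum (label \<E>) (label \<F>)"
  by (simp_all add: bes_par_def bes_seq_def bes_plus_def)

lemma events_operations [simp]:
  "events (bes_par \<E> \<F>) = Inl ` events \<E> \<union> Inr ` events \<F>"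
  "events (bes_seq \<E> \<F>) = Inl ` events \<E> \<union> Inr ` events \<F>"
  "events (bes_plus \<E> \<F>) = Inl ` events \<E> \<union> Inr ` events \<F>"
  by (simp_all add: bes_par_def bes_seq_def bes_plus_def)

lemma traces_zero: "is_zero \<E> \<Longrightarrow> traces \<E> = {[]}"
  by (auto simp: is_zero_def traces_def)

text \<open>A zero left operand has no exit sets, and a zero right operand has no events to be
  guarded.\<close>

lemma interleavings_zero:
  fixes \<E> :: "('a, 'w::finite) bes" and \<F> :: "('b, 'w) bes"
  assumes "is_zero \<E> \<or> is_zero \<F>"
  shows "interleavings (exits \<E>) \<E> \<F> = interleavings {} \<E> \<F>"
proof -
  have "guarded \<Phi> \<alpha>" if "rights \<alpha> = []" for \<Phi> and \<alpha> :: "('a + 'b) list"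
  proof -
    have "prefix (\<beta> @ [Inr b]) \<alpha> \<Longrightarrow> Inr b \<in> set \<alpha>" for \<beta> b
      by (auto simp: prefix_def)
    then show ?thesis
      using that unfolding guarded_def by (metis in_set_rights empty_iff empty_set)
  qed
  then show ?thesis
    using assms by (auto simp: interleavings_def is_zero_def guarded_empty traces_zero)
qed

text \<open>\<open>bes_seq\<close> guards only the initial events of \<open>\<F>\<close>, whereas
  \<open>interleavings\<close> guards all of them. The two agree because a non-initial event needs
  an earlier event of \<open>\<F>\<close> through one of its own bundles, and then
  \<open>guarded_ready\<close> applies.\<close>

lemma traces_seq:
  fixes \<E> :: "('a, 'w::finite) bes" and \<F> :: "('b, 'w) bes"
  shows "traces (bes_seq \<E> \<F>) = interleavings (exits \<E>) \<E> \<F>"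
proof (cases "is_zero \<E> \<or> is_zero \<F>")
  case True
  then show ?thesis
    by (simp add: bes_seq_def traces_par interleavings_zero)
next
  case False
  let ?S = "bes_seq \<E> \<F>" and ?P = "bes_par \<E> \<F>"
  have S: "conflict ?S = conflict ?P" "events ?S = events ?P"
    "bundles ?S = bundles ?P \<union> {(Inl ` x, Inr e) |x e. x \<in> exits \<E> \<and> e \<in> initial \<F>}"
    using False by (auto simp: bes_seq_def)
  have rd: "(\<forall>x\<in>exits \<E>. set \<alpha> \<inter> Inl ` x \<noteq> {}) \<longleftrightarrow> ready (exits \<E>) \<alpha>" for \<alpha> :: "('a + 'b) list"
    by (fastforce simp: ready_def)
  have "\<alpha> \<in> traces ?S \<longleftrightarrow> \<alpha> \<in> traces ?P \<and> guarded (exits \<E>) \<alpha>" for \<alpha>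
  proof (induction \<alpha> rule: rev_induct)
    case (snoc a \<alpha>)
    have b: "(\<forall>x. (x, a) \<in> bundles ?S \<longrightarrow> set \<alpha> \<inter> x \<noteq> {}) \<longleftrightarrow>
        (\<forall>x. (x, a) \<in> bundles ?P \<longrightarrow> set \<alpha> \<inter> x \<noteq> {}) \<and>
        (\<forall>e. a = Inr e \<and> e \<in> initial \<F> \<longrightarrow> ready (exits \<E>) \<alpha>)"
      unfolding S(3) rd[symmetric] by auto
    \<comment> \<open>\<open>K\<close> collects what both structures demand of the new event, which
      leaves the guard as the only difference.\<close>
    define K where "K \<longleftrightarrow> a \<in> events ?P \<and> a \<notin> set \<alpha> \<and>
      (\<forall>e'\<in>insert a (set \<alpha>). (a, e') \<notin> conflict ?P \<and> (e', a) \<notin> conflict ?P) \<and>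
      (\<forall>x. (x, a) \<in> bundles ?P \<longrightarrow> set \<alpha> \<inter> x \<noteq> {})"
    have P: "\<alpha> @ [a] \<in> traces ?P \<longleftrightarrow> \<alpha> \<in> traces ?P \<and> K"
      unfolding traces_snoc K_def ..
    have Q: "\<alpha> @ [a] \<in> traces ?S \<longleftrightarrow>
        \<alpha> \<in> traces ?S \<and> K \<and> (\<forall>e. a = Inr e \<and> e \<in> initial \<F> \<longrightarrow> ready (exits \<E>) \<alpha>)"
      unfolding traces_snoc b K_def S(1,2) by (simp only: conj_assoc)
    show ?case
    proof (cases a)
      case (Inl e)
      then show ?thesis
        using snoc P Q by auto
    next
      case (Inr e)
      have "ready (exits \<E>) \<alpha>"
        if tr: "\<alpha> @ [a] \<in> traces ?P" and gd: "guarded (exits \<E>) \<alpha>" and ni: "e \<notin> initial \<F>"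
      proof (rule guarded_ready)
        have e: "rights \<alpha> @ [e] \<in> traces \<F>"
          using tr by (simp add: traces_par interleavings_def Inr)
        then obtain x where "(x, e) \<in> bundles \<F>"
          using ni by (auto simp: initial_def traces_snoc)
        then show "rights \<alpha> \<noteq> []"
          using e by (auto simp: traces_snoc)
      qed (fact gd)
      then show ?thesis
        using snoc P Q by (auto simp: Inr)
    qed
  qed simp
  then show ?thesis
    by (auto simp: traces_par interleavings_def guarded_empty)
qed

lemma bundles_plus: "bundles (bes_plus \<E> \<F>) = bundles (bes_par \<E> \<F>)"
  by (simp add: bes_plus_def)

text \<open>Mixing fails at the first change of side. The first event of a trace is initial, and the
  first event from the other side can have no bundle, since its bundles stay on its own side, where
  nothing has happened yet. Two such events are in conflict.\<close>

lemma traces_plus: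
  "traces (bes_plus \<E> \<F>) = map Inl ` traces \<E> \<union> map Inr ` traces \<F>"
proof -
  let ?S = "bes_plus \<E> \<F>"
  have left: "map Inl \<alpha> \<in> traces ?S \<longleftrightarrow> \<alpha> \<in> traces \<E>" for \<alpha>
  proof (induction \<alpha> rule: rev_induct)
    case (snoc e \<alpha>)
    have "(\<forall>x. (x, Inl e) \<in> bundles ?S \<longrightarrow> Inl ` set \<alpha> \<inter> x \<noteq> {}) \<longleftrightarrow>
        (\<forall>x. (x, e) \<in> bundles \<E> \<longrightarrow> Inl ` set \<alpha> \<inter> Inl ` x \<noteq> {})"
      by (simp only: bundles_plus) (auto simp: bes_par_def simp flip: image_Int)
    then have "(\<forall>x. (x, Inl e) \<in> bundles ?S \<longrightarrow> Inl ` set \<alpha> \<inter> x \<noteq> {}) \<longleftrightarrow>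
        (\<forall>x. (x, e) \<in> bundles \<E> \<longrightarrow> set \<alpha> \<inter> x \<noteq> {})"
      by (simp flip: image_Int)
    moreover have "(\<forall>e'\<in>insert (Inl e) (Inl ` set \<alpha>).
          (Inl e, e') \<notin> conflict ?S \<and> (e', Inl e) \<notin> conflict ?S) \<longleftrightarrow>
        (\<forall>e'\<in>insert e (set \<alpha>). (e, e') \<notin> conflict \<E> \<and> (e', e) \<notin> conflict \<E>)"
      by (auto simp: bes_plus_def bes_par_def sym_closure_def)
    ultimately show ?case
      using snoc by (auto simp: traces_snoc)
  qed simp
  have right: "map Inr \<alpha> \<in> traces ?S \<longleftrightarrow> \<alpha> \<in> traces \<F>" for \<alpha>
  proof (induction \<alpha> rule: rev_induct)
    case (snoc e \<alpha>)
    have "(\<forall>x. (x, Inr e) \<in> bundles ?S \<longrightarrow> Inr ` set \<alpha> \<inter> x \<noteq> {}) \<longleftrightarrow>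
        (\<forall>x. (x, e) \<in> bundles \<F> \<longrightarrow> Inr ` set \<alpha> \<inter> Inr ` x \<noteq> {})"
      by (simp only: bundles_plus) (auto simp: bes_par_def simp flip: image_Int)
    then have "(\<forall>x. (x, Inr e) \<in> bundles ?S \<longrightarrow> Inr ` set \<alpha> \<inter> x \<noteq> {}) \<longleftrightarrow>
        (\<forall>x. (x, e) \<in> bundles \<F> \<longrightarrow> set \<alpha> \<inter> x \<noteq> {})"
      by (simp flip: image_Int)
    moreover have "(\<forall>e'\<in>insert (Inr e) (Inr ` set \<alpha>).
          (Inr e, e') \<notin> conflict ?S \<and> (e', Inr e) \<notin> conflict ?S) \<longleftrightarrow>
        (\<forall>e'\<in>insert e (set \<alpha>). (e, e') \<notin> conflict \<F> \<and> (e', e) \<notin> conflict \<F>)"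
      by (auto simp: bes_plus_def bes_par_def sym_closure_def)
    ultimately show ?case
      using snoc by (auto simp: traces_snoc)
  qed simp
  have hd_initial: "hd \<alpha> \<in> initial ?S" if "\<alpha> \<in> traces ?S" "\<alpha> \<noteq> []" for \<alpha>
    using that traces_append[of "[hd \<alpha>]" "tl \<alpha>" ?S] traces_snoc[of "[]" "hd \<alpha>" ?S]
    by (auto simp: initial_def)
  have sides: "(\<exists>\<beta>. \<alpha> = map Inl \<beta>) \<or> (\<exists>\<beta>. \<alpha> = map Inr \<beta>)" if "\<alpha> \<in> traces ?S" for \<alpha>
    using that
  proof (induction \<alpha> rule: rev_induct)
    case (snoc a \<alpha>)
    then have tr: "\<alpha> \<in> traces ?S"
      using traces_append by blast
    consider "\<alpha> = []" |
        \<beta> where "\<alpha> = map Inl \<beta>" "\<beta> \<noteq> []" | \<beta> where "\<alpha> = map Inr \<beta>" "\<beta> \<noteq> []"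
      using snoc.IH[OF tr] map_is_Nil_conv by metis
    then show ?case
    proof cases
      case 1
      then show ?thesis
        by (cases a) (auto simp: Cons_eq_map_conv)
    next
      case (2 \<beta>)
      show ?thesis
      proof (cases a)
        case (Inl e)
        then show ?thesis
          using 2 by (intro disjI1 exI[of _ "\<beta> @ [e]"]) simp
      next
        case (Inr e)
        have "Inl (hd \<beta>) \<in> initial ?S"
          using hd_initial[OF tr] 2 by (simp add: hd_map)
        then have hd: "hd \<beta> \<in> initial \<E>"
          by (fastforce simp: initial_def bes_plus_def bes_par_def split: if_splits)
        have "(x, e) \<notin> bundles \<F>" for x
        proof
          assume "(x, e) \<in> bundles \<F>"
          then have "(Inr ` x, a) \<in> bundles ?S"
            by (auto simp: bes_plus_def bes_par_def Inr)
          then show False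
            using snoc.prems 2 by (auto simp: traces_snoc)
        qed
        moreover have "e \<in> events \<F>"
          using snoc.prems by (auto simp: traces_snoc Inr)
        ultimately have e: "e \<in> initial \<F>"
          by (simp add: initial_def)
        \<comment> \<open>Cross conflicts are present only if neither operand is zero; here both
          have an event.\<close>
        have "\<not> is_zero \<E>" "\<not> is_zero \<F>"
          using hd e by (auto simp: is_zero_def initial_def)
        then have "(Inl (hd \<beta>), a) \<in> conflict ?S"
          using hd e by (auto simp: bes_plus_def Inr sym_closure_def)
        moreover have "Inl (hd \<beta>) \<in> set \<alpha>"
          using 2 by simp
        ultimately show ?thesis
          using snoc.prems unfolding traces_snoc by blast
      qed
    next
      case (3 \<beta>)
      show ?thesis
      proof (cases a)
        case (Inr e)
        then show ?thesis
          using 3 by (intro disjI2 exI[of _ "\<beta> @ [e]"]) simp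
      next
        case (Inl e)
        have "Inr (hd \<beta>) \<in> initial ?S"
          using hd_initial[OF tr] 3 by (simp add: hd_map)
        then have hd: "hd \<beta> \<in> initial \<F>"
          by (fastforce simp: initial_def bes_plus_def bes_par_def split: if_splits)
        have "(x, e) \<notin> bundles \<E>" for x
        proof
          assume "(x, e) \<in> bundles \<E>"
          then have "(Inl ` x, a) \<in> bundles ?S"
            by (auto simp: bes_plus_def bes_par_def Inl)
          then show False
            using snoc.prems 3 by (auto simp: traces_snoc)
        qed
        moreover have "e \<in> events \<E>"
          using snoc.prems by (auto simp: traces_snoc Inl)
        ultimately have e: "e \<in> initial \<E>"
          by (simp add: initial_def)
        have "\<not> is_zero \<E>" "\<not> is_zero \<F>"
          using hd e by (auto simp: is_zero_def initial_def)
        then have "(a, Inr (hd \<beta>)) \<in> conflict ?S"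
          using hd e by (auto simp: bes_plus_def Inl sym_closure_def)
        moreover have "Inr (hd \<beta>) \<in> set \<alpha>"
          using 3 by simp
        ultimately show ?thesis
          using snoc.prems unfolding traces_snoc by blast
      qed
    qed
  qed simp
  show ?thesis
  proof (intro equalityI subsetI)
    fix \<alpha> assume "\<alpha> \<in> traces ?S"
    then show "\<alpha> \<in> map Inl ` traces \<E> \<union> map Inr ` traces \<F>"
      using sides[of \<alpha>] left right by blast
  next
    fix \<alpha> assume "\<alpha> \<in> map Inl ` traces \<E> \<union> map Inr ` traces \<F>"
    then show "\<alpha> \<in> traces ?S"
      using left right by blast
  qed
qed


section \<open>Monotonicity\<close>

text \<open>Each step has to peel off the last event, because \<open>f\<close> acts on the history
  before it; hence the reversed list. A right event is replaced by what \<open>f\<close> adds to its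
  previous output, and \<open>drop\<close> recovers this: nothing or one event if \<open>f\<close>
  is a t-simulation and its argument a trace.\<close>

fun lift_rev :: "('a list \<Rightarrow> 'b list) \<Rightarrow> ('c + 'a) list \<Rightarrow> ('c + 'b) list" where
  "lift_rev f [] = []"
| "lift_rev f (Inl c # \<alpha>) = lift_rev f \<alpha> @ [Inl c]"
| "lift_rev f (Inr a # \<alpha>) = lift_rev f \<alpha> @
     map Inr (drop (length (f (rights (rev \<alpha>)))) (f (rights (rev \<alpha>) @ [a])))"

definition lift_right :: "('a list \<Rightarrow> 'b list) \<Rightarrow> ('c + 'a) list \<Rightarrow> ('c + 'b) list" where
  "lift_right f \<alpha> = lift_rev f (rev \<alpha>)"

lemma lift_right_simps [simp]:
  "lift_right f [] = []"
  "lift_right f (\<alpha> @ [Inl c]) = lift_right f \<alpha> @ [Inl c]"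
  "lift_right f (\<alpha> @ [Inr a]) = lift_right f \<alpha> @
     map Inr (drop (length (f (rights \<alpha>))) (f (rights \<alpha> @ [a])))"
  by (simp_all add: lift_right_def)

lemma lefts_lift_right [simp]: "lefts (lift_right f \<alpha>) = lefts \<alpha>"
proof (induction \<alpha> rule: rev_induct)
  case (snoc a \<alpha>)
  then show ?case
    by (cases a) simp_all
qed simp

lemma ready_lefts: "lefts \<alpha> = lefts \<beta> \<Longrightarrow> ready \<Phi> \<alpha> \<longleftrightarrow> ready \<Phi> \<beta>"
  unfolding ready_def by (metis in_set_lefts)

text \<open>Once the guard is open, the left operand no longer restricts the right one. A completion
  \<open>es\<close> found in \<open>\<F>\<close> can thus be replayed after an interleaving.\<close>

lemma interleavings_snoc_Inr:
  assumes "\<alpha> \<in> interleavings \<Phi> \<E> \<F>" and "ready \<Phi> \<alpha>"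
  shows "\<alpha> @ map Inr es \<in> interleavings \<Phi> \<E> \<F> \<longleftrightarrow> rights \<alpha> @ es \<in> traces \<F>"
  using assms by (simp add: interleavings_def guarded_append_Inr)

text \<open>The guard comes from the left operand, which does not change, so the same
  \<open>\<Phi>\<close> appears on both sides and one argument serves \<open>bes_par\<close> and
  \<open>bes_seq\<close>. The condition on \<open>[]\<close> handles maximal traces with an empty
  right projection, about which clause (iii) for \<open>f\<close> says nothing.\<close>

lemma interleavings_right_mono:
  fixes \<E> :: "('a, 'w::finite) bes" and \<F> :: "('b, 'w) bes" and \<G> :: "('c, 'w) bes"
  assumes sim: "\<E> \<sqsubseteq>\<^sub>s\<^sub>i\<^sub>m \<F>"
    and empty: "[] \<in> max_traces \<E> \<longrightarrow> [] \<in> weak_max_traces \<F>"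
    and P: "traces \<P> = interleavings \<Phi> \<G> \<E>" "label \<P> = case_sum (label \<G>) (label \<E>)"
    and Q: "traces \<Q> = interleavings \<Phi> \<G> \<F>" "label \<Q> = case_sum (label \<G>) (label \<F>)"
      "events \<Q> = Inl ` events \<G> \<union> Inr ` events \<F>"
  shows "\<P> \<sqsubseteq>\<^sub>s\<^sub>i\<^sub>m \<Q>"
proof -
  obtain f where f: "t_simulation \<E> \<F> f"
    using sim by (auto simp: sim_le_def)
  have f_tr: "f \<beta> \<in> traces \<F>" if "\<beta> \<in> traces \<E>" for \<beta>
    using f that by (simp add: t_simulation_def)
  have f_Nil: "f [] = []"
    using f by (simp add: t_simulation_def)
  have f_fin: "finite {\<beta> \<in> traces \<E>. f \<beta> = \<gamma>}" if "\<gamma> \<in> traces \<F>" for \<gamma>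
    using f that by (simp add: t_simulation_def)
  have f_snoc: "f (\<beta> @ [e]) = f \<beta> \<and> label \<E> e \<sqsubseteq>\<^sub>H skip \<or>
      (\<exists>e'\<in>events \<F>. label \<E> e \<sqsubseteq>\<^sub>H label \<F> e' \<and> f (\<beta> @ [e]) = f \<beta> @ [e'])"
    if "\<beta> @ [e] \<in> traces \<E>" for \<beta> e
    using f that by (simp add: t_simulation_def)
  have f_max: "(\<exists>e'\<in>events \<F>. label \<E> e \<sqsubseteq>\<^sub>H label \<F> e' \<and> f (\<beta> @ [e]) = f \<beta> @ [e'])"
      "f (\<beta> @ [e]) \<in> weak_max_traces \<F>"
    if "\<beta> @ [e] \<in> max_traces \<E>" for \<beta> e
    using f that by (simp_all add: t_simulation_def)
  have prefix: "\<alpha> \<in> interleavings \<Phi> \<G> \<E>" if "\<alpha> @ [a] \<in> interleavings \<Phi> \<G> \<E>" for \<alpha> a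
    using that traces_append unfolding P(1)[symmetric] by blast
  define g where "g = (lift_right f :: ('c + 'a) list \<Rightarrow> ('c + 'b) list)"
  have g_simps: "g [] = []" "g (\<alpha> @ [Inl c]) = g \<alpha> @ [Inl c]"
    "g (\<alpha> @ [Inr a]) = g \<alpha> @ map Inr (drop (length (f (rights \<alpha>))) (f (rights \<alpha> @ [a])))"
    "lefts (g \<alpha>) = lefts \<alpha>" for \<alpha> a c
    by (simp_all add: g_def)
  \<comment> \<open>The left events are copied and readiness depends on them alone, so the guard
    survives when the right events are replaced.\<close>
  have g: "rights (g \<alpha>) = f (rights \<alpha>) \<and> guarded \<Phi> (g \<alpha>)" if "\<alpha> \<in> interleavings \<Phi> \<G> \<E>" for \<alpha>
    using that
  proof (induction \<alpha> rule: rev_induct)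
    case Nil
    then show ?case
      by (simp add: g_simps f_Nil)
  next
    case (snoc a \<alpha>)
    then have IH: "rights (g \<alpha>) = f (rights \<alpha>)" "guarded \<Phi> (g \<alpha>)"
      using prefix by blast+
    show ?case
    proof (cases a)
      case (Inl c)
      then show ?thesis
        using IH by (simp add: g_simps)
    next
      case (Inr e)
      have tr: "rights \<alpha> @ [e] \<in> traces \<E>" and "ready \<Phi> \<alpha>"
        using snoc.prems by (simp_all add: interleavings_def Inr)
      then have "ready \<Phi> (g \<alpha>)"
        using ready_lefts[OF g_simps(4)] by blast
      then show ?thesis
        using f_snoc[OF tr] IH guarded_append_Inr[OF IH(2)] by (auto simp: g_simps Inr)
    qed
  qed
  have g_tr: "g \<alpha> \<in> interleavings \<Phi> \<G> \<F>" if "\<alpha> \<in> interleavings \<Phi> \<G> \<E>" for \<alpha>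
    using g[OF that] that f_tr by (simp add: interleavings_def g_simps)
  \<comment> \<open>Left events always produce an event, so \<open>emit\<close> concerns right
    events only. It will come from clause (ii) in general and from clause (iii) for maximal
    traces.\<close>
  have keep: "\<exists>e'\<in>events \<Q>. label \<P> a \<sqsubseteq>\<^sub>H label \<Q> e' \<and> g (\<alpha> @ [a]) = g \<alpha> @ [e']"
    if tr: "\<alpha> @ [a] \<in> interleavings \<Phi> \<G> \<E>"
      and emit: "\<And>e. a = Inr e \<Longrightarrow>
        \<exists>e'\<in>events \<F>. label \<E> e \<sqsubseteq>\<^sub>H label \<F> e' \<and> f (rights \<alpha> @ [e]) = f (rights \<alpha>) @ [e']" for \<alpha> a
  proof (cases a)
    case (Inl c)
    then have "c \<in> events \<G>"
      using tr set_traces[of "lefts \<alpha> @ [c]" \<G> c] by (simp add: interleavings_def)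
    then show ?thesis
      using Inl by (auto simp: g_simps P(2) Q(2,3) prog_le_def)
  next
    case (Inr e)
    then obtain e' where "e' \<in> events \<F>" "label \<E> e \<sqsubseteq>\<^sub>H label \<F> e'"
        "f (rights \<alpha> @ [e]) = f (rights \<alpha>) @ [e']"
      using emit by blast
    then show ?thesis
      using Inr by (intro bexI[of _ "Inr e'"]) (simp_all add: g_simps P(2) Q(2,3))
  qed
  have "t_simulation \<P> \<Q> g"
  proof (rule t_simulationI)
    show "g [] = []"
      by (rule g_simps)
    show "g \<alpha> \<in> traces \<Q>" if "\<alpha> \<in> traces \<P>" for \<alpha>
      using that g_tr unfolding P Q by blast
    show "finite {\<alpha> \<in> traces \<P>. g \<alpha> = \<beta>}" if "\<beta> \<in> traces \<Q>" for \<beta>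
    proof (rule finite_subset)
      \<comment> \<open>The left projection is that of \<open>\<beta>\<close>, the right one lies in
        a finite fibre of \<open>f\<close>, and each such pair has finitely many
        interleavings.\<close>
      let ?B = "{\<gamma> \<in> traces \<E>. f \<gamma> = rights \<beta>}"
      show "finite (\<Union>\<gamma>\<in>?B. {\<alpha>. lefts \<alpha> = lefts \<beta> \<and> rights \<alpha> = \<gamma>})"
        using that f_fin[of "rights \<beta>"] by (intro finite_UN_I finite_interleavings)
          (simp_all add: Q(1) interleavings_def)
      show "{\<alpha> \<in> traces \<P>. g \<alpha> = \<beta>} \<subseteq> (\<Union>\<gamma>\<in>?B. {\<alpha>. lefts \<alpha> = lefts \<beta> \<and> rights \<alpha> = \<gamma>})"
      proof
        fix \<alpha> assume "\<alpha> \<in> {\<alpha> \<in> traces \<P>. g \<alpha> = \<beta>}"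
        then have "\<alpha> \<in> interleavings \<Phi> \<G> \<E>" "g \<alpha> = \<beta>"
          by (simp_all add: P(1))
        then show "\<alpha> \<in> (\<Union>\<gamma>\<in>?B. {\<alpha>. lefts \<alpha> = lefts \<beta> \<and> rights \<alpha> = \<gamma>})"
          using g g_simps(4)[of \<alpha>] by (auto simp: interleavings_def)
      qed
    qed
  next
    fix \<alpha> a assume tr: "\<alpha> @ [a] \<in> traces \<P>"
    show "g (\<alpha> @ [a]) = g \<alpha> \<and> label \<P> a \<sqsubseteq>\<^sub>H skip \<or>
        (\<exists>e'\<in>events \<Q>. label \<P> a \<sqsubseteq>\<^sub>H label \<Q> e' \<and> g (\<alpha> @ [a]) = g \<alpha> @ [e'])"
    proof (cases "\<exists>e. a = Inr e \<and> f (rights \<alpha> @ [e]) = f (rights \<alpha>) \<and> label \<E> e \<sqsubseteq>\<^sub>H skip")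
      case True
      then show ?thesis
        by (auto simp: g_simps P(2))
    next
      case False
      have "rights \<alpha> @ [e] \<in> traces \<E>" if "a = Inr e" for e
        using tr that by (simp add: P(1) interleavings_def)
      then show ?thesis
        using keep[OF tr[unfolded P(1)]] f_snoc False by blast
    qed
  next
    fix \<alpha> a assume mx: "\<alpha> @ [a] \<in> max_traces \<P>"
    let ?\<alpha> = "\<alpha> @ [a]"
    have tr: "?\<alpha> \<in> interleavings \<Phi> \<G> \<E>"
      and ext: "?\<alpha> @ [b] \<notin> interleavings \<Phi> \<G> \<E>" for b
      using mx unfolding max_traces_iff P(1) by blast+
    \<comment> \<open>Left events are never guarded, so the right operand cannot block a left
      extension.\<close>
    have lefts_ext: "lefts ?\<alpha> @ [c] \<notin> traces \<G>" for c
      using ext[of "Inl c"] tr by (auto simp: interleavings_def simp flip: append_assoc)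
    have rights_max: "rights ?\<alpha> \<in> max_traces \<E>" if "ready \<Phi> ?\<alpha>"
    proof -
      have "rights ?\<alpha> @ [e] \<notin> traces \<E>" for e
        using ext[of "Inr e"] interleavings_snoc_Inr[OF tr that, of "[e]"] by simp
      then show ?thesis
        using tr unfolding max_traces_iff interleavings_def by blast
    qed
    \<comment> \<open>A trailing right event shows that the guard is open. The right projection is
      then maximal as well, and clause (iii) makes \<open>f\<close> emit an event.\<close>
    have "ready \<Phi> ?\<alpha>" if "a = Inr e" for e
      using guarded_ready[of \<Phi> ?\<alpha>] tr that by (simp add: interleavings_def)
    then have "rights \<alpha> @ [e] \<in> max_traces \<E>" if "a = Inr e" for e
      using rights_max that by simp
    then have "\<exists>e'\<in>events \<Q>. label \<P> a \<sqsubseteq>\<^sub>H label \<Q> e' \<and> g ?\<alpha> = g \<alpha> @ [e']"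
      by (intro keep[OF tr] f_max(1))
    moreover have "g ?\<alpha> \<in> weak_max_traces \<Q>"
    proof (cases "ready \<Phi> ?\<alpha>")
      case True
      have rdy: "ready \<Phi> (g ?\<alpha>)"
        using ready_lefts[OF g_simps(4)] True by blast
      \<comment> \<open>An empty right projection is the place where the condition on
        \<open>[]\<close> enters.\<close>
      have "f (rights ?\<alpha>) \<in> weak_max_traces \<F>"
        using rights_max[OF True] empty f_Nil f_max(2) by (cases "rights ?\<alpha>" rule: rev_cases) auto
      then obtain es where es: "f (rights ?\<alpha>) @ es \<in> max_traces \<F>"
          "\<forall>e\<in>set es. skip \<sqsubseteq>\<^sub>H label \<F> e"
        by (rule weak_max_tracesE)
      show ?thesis
      proof (rule weak_max_tracesI)
        have in_Q: "g ?\<alpha> @ map Inr es \<in> interleavings \<Phi> \<G> \<F>"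
          using interleavings_snoc_Inr[OF g_tr[OF tr] rdy] g[OF tr] es(1) by (simp add: max_traces_iff)
        moreover have "(g ?\<alpha> @ map Inr es) @ [b] \<notin> interleavings \<Phi> \<G> \<F>" for b
        proof (cases b)
          case (Inl c)
          have "lefts ((g ?\<alpha> @ map Inr es) @ [b]) = lefts ?\<alpha> @ [c]"
            by (simp add: Inl g_simps)
          then show ?thesis
            using lefts_ext[of c] by (simp add: interleavings_def)
        next
          case (Inr e)
          have "rights ((g ?\<alpha> @ map Inr es) @ [b]) = (f (rights ?\<alpha>) @ es) @ [e]"
            using g[OF tr] by (simp add: Inr)
          then show ?thesis
            using es(1) by (simp add: interleavings_def max_traces_iff)
        qed
        ultimately show "g ?\<alpha> @ map Inr es \<in> max_traces \<Q>"
          unfolding max_traces_iff Q(1) by blast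
      qed (use es(2) in \<open>auto simp: Q(2)\<close>)
    next
      case False
      \<comment> \<open>The left operand got stuck before opening the guard. No event of either side
        can follow, so the image is maximal itself and the completion is empty.\<close>
      have nr: "\<not> ready \<Phi> (g ?\<alpha>)"
        using ready_lefts[OF g_simps(4)] False by blast
      have "g ?\<alpha> @ [b] \<notin> interleavings \<Phi> \<G> \<F>" for b
      proof (cases b)
        case (Inl c)
        have "lefts (g ?\<alpha> @ [b]) = lefts ?\<alpha> @ [c]"
          by (simp add: Inl g_simps)
        then show ?thesis
          using lefts_ext[of c] by (simp add: interleavings_def)
      next
        case (Inr e)
        then show ?thesis
          using nr by (simp add: interleavings_def)
      qed
      then have "g ?\<alpha> @ [] \<in> max_traces \<Q>"
        unfolding max_traces_iff Q(1) using g_tr[OF tr] by simp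
      then show ?thesis
        by (rule weak_max_tracesI) simp
    qed
    ultimately show "(\<exists>e'\<in>events \<Q>. label \<P> a \<sqsubseteq>\<^sub>H label \<Q> e' \<and> g ?\<alpha> = g \<alpha> @ [e']) \<and>
        g ?\<alpha> \<in> weak_max_traces \<Q>" ..
  qed
  then show ?thesis
    by (auto simp: sim_le_def)
qed

lemma seq_mono_right:
  assumes "\<E> \<sqsubseteq>\<^sub>s\<^sub>i\<^sub>m \<F>" and "[] \<in> max_traces \<E> \<longrightarrow> [] \<in> weak_max_traces \<F>"
  shows "bes_seq \<G> \<E> \<sqsubseteq>\<^sub>s\<^sub>i\<^sub>m bes_seq \<G> \<F>"
  by (rule interleavings_right_mono[OF assms]) (simp_all add: traces_seq)

lemma par_mono_right:
  assumes "\<E> \<sqsubseteq>\<^sub>s\<^sub>i\<^sub>m \<F>" and "[] \<in> max_traces \<E> \<longrightarrow> [] \<in> weak_max_traces \<F>"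
  shows "bes_par \<G> \<E> \<sqsubseteq>\<^sub>s\<^sub>i\<^sub>m bes_par \<G> \<F>"
  by (rule interleavings_right_mono[OF assms]) (simp_all add: traces_par)

section \<open>Renamings of parallel compositions, and monotonicity of sums\<close>

lemma bundles_par:
  "{x. (x, Inl a) \<in> bundles (bes_par \<E> \<F>)} = (`) Inl ` {x. (x, a) \<in> bundles \<E>}"
  "{x. (x, Inr b) \<in> bundles (bes_par \<E> \<F>)} = (`) Inr ` {x. (x, b) \<in> bundles \<F>}"
  by (auto simp: bes_par_def)

lemma trace_iso_par_commute:
  "trace_iso (case_sum Inr Inl) (bes_par \<E> \<F>) (bes_par \<F> \<E>)"
proof (rule trace_isoI)
  show "inj (case_sum Inr Inl)"
    by (auto simp: inj_def split: sum.splits)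
  show "{x. (x, case_sum Inr Inl a) \<in> bundles (bes_par \<F> \<E>)} =
      (`) (case_sum Inr Inl) ` {x. (x, a) \<in> bundles (bes_par \<E> \<F>)}" for a
    by (cases a) (simp_all add: bundles_par image_image)
qed (auto simp: bes_par_def image_Un image_image split: sum.splits)

lemma trace_iso_par_assoc:
  "trace_iso (case_sum (Inl \<circ> Inl) (case_sum (Inl \<circ> Inr) Inr))
     (bes_par \<E> (bes_par \<F> \<G>)) (bes_par (bes_par \<E> \<F>) \<G>)" (is "trace_iso ?h ?P ?Q")
proof (rule trace_isoI)
  show "inj ?h"
    by (auto simp: inj_def split: sum.splits)
  show "{x. (x, ?h a) \<in> bundles ?Q} = (`) ?h ` {x. (x, a) \<in> bundles ?P}" for a
  proof (cases a)
    case (Inr b)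
    then show ?thesis
      by (cases b) (simp_all add: bundles_par image_image)
  qed (simp add: bundles_par image_image)
qed (auto simp: bes_par_def image_Un image_image split: sum.splits)

text \<open>The equivalences can fail for \<open>[]\<close>, which is a trace of both summands and
  may be extended in either.\<close>

lemma max_traces_plus:
  "\<alpha> \<noteq> [] \<Longrightarrow> map Inl \<alpha> \<in> max_traces (bes_plus \<E> \<F>) \<longleftrightarrow> \<alpha> \<in> max_traces \<E>"
  "\<beta> \<noteq> [] \<Longrightarrow> map Inr \<beta> \<in> max_traces (bes_plus \<E> \<F>) \<longleftrightarrow> \<beta> \<in> max_traces \<F>"
proof -
  have inl: "map Inl \<alpha> \<in> traces (bes_plus \<E> \<F>) \<longleftrightarrow> \<alpha> \<in> traces \<E>" if "\<alpha> \<noteq> []" for \<alpha>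
    unfolding traces_plus Un_iff inj_image_mem_iff[OF inj_mapI[OF inj_Inl]]
    using that by (cases \<alpha>) auto
  have inr: "map Inr \<beta> \<in> traces (bes_plus \<E> \<F>) \<longleftrightarrow> \<beta> \<in> traces \<F>" if "\<beta> \<noteq> []" for \<beta>
    unfolding traces_plus Un_iff inj_image_mem_iff[OF inj_mapI[OF inj_Inr]]
    using that by (cases \<beta>) auto
  have mixed: "map Inl \<alpha> @ [Inr b] \<notin> traces (bes_plus \<E> \<F>)" if "\<alpha> \<noteq> []" for \<alpha> b
    using that by (cases \<alpha>) (auto simp: traces_plus append_eq_map_conv Cons_eq_map_conv)
  have mixed': "map Inr \<beta> @ [Inl a] \<notin> traces (bes_plus \<E> \<F>)" if "\<beta> \<noteq> []" for \<beta> a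
    using that by (cases \<beta>) (auto simp: traces_plus append_eq_map_conv Cons_eq_map_conv)
  show "map Inl \<alpha> \<in> max_traces (bes_plus \<E> \<F>) \<longleftrightarrow> \<alpha> \<in> max_traces \<E>" if "\<alpha> \<noteq> []" for \<alpha>
    using inl[OF that] inl[of "\<alpha> @ [_]"] mixed[OF that]
    by (simp add: max_traces_iff split_sum_all)
  show "map Inr \<beta> \<in> max_traces (bes_plus \<E> \<F>) \<longleftrightarrow> \<beta> \<in> max_traces \<F>" if "\<beta> \<noteq> []" for \<beta>
    using inr[OF that] inr[of "\<beta> @ [_]"] mixed'[OF that]
    by (simp add: max_traces_iff split_sum_all)
qed

lemma plus_mono_right:
  fixes \<E> :: "('a, 'w::finite) bes" and \<F> :: "('b, 'w) bes" and \<G> :: "('c, 'w) bes"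
  assumes "\<E> \<sqsubseteq>\<^sub>s\<^sub>i\<^sub>m \<F>"
  shows "bes_plus \<G> \<E> \<sqsubseteq>\<^sub>s\<^sub>i\<^sub>m bes_plus \<G> \<F>"
proof -
  obtain f where f: "t_simulation \<E> \<F> f"
    using assms by (auto simp: sim_le_def)
  let ?P = "bes_plus \<G> \<E>" and ?Q = "bes_plus \<G> \<F>"
  \<comment> \<open>The branches agree on \<open>[]\<close>, the only trace common to both summands,
    because \<open>f [] = []\<close>.\<close>
  define g :: "('c + 'a) list \<Rightarrow> ('c + 'b) list" where
    "g \<alpha> = (if rights \<alpha> = [] then map Inl (lefts \<alpha>) else map Inr (f (rights \<alpha>)))" for \<alpha>
  have rights_Inl: "rights (map Inl \<gamma>) = []" and lefts_Inl: "lefts (map Inl \<gamma>) = \<gamma>" for \<gamma> :: "'c list"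
    by (induction \<gamma>) simp_all
  have f_Nil: "f [] = []"
    using f by (simp add: t_simulation_def)
  have g_Inl: "g (map Inl \<gamma>) = map Inl \<gamma>" for \<gamma>
    by (simp add: g_def rights_Inl lefts_Inl)
  have g_Inr: "g (map Inr \<beta>) = map Inr (f \<beta>)" for \<beta>
    by (simp add: g_def f_Nil)
  have cases_snoc: thesis
    if "\<alpha> @ [a] \<in> traces ?P"
      and "\<And>\<gamma> c. \<alpha> = map Inl \<gamma> \<Longrightarrow> a = Inl c \<Longrightarrow> \<gamma> @ [c] \<in> traces \<G> \<Longrightarrow> c \<in> events \<G> \<Longrightarrow> thesis"
      and "\<And>\<beta> e. \<alpha> = map Inr \<beta> \<Longrightarrow> a = Inr e \<Longrightarrow> \<beta> @ [e] \<in> traces \<E> \<Longrightarrow> thesis"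
    for \<alpha> a thesis
  proof -
    have "(\<exists>\<gamma> c. \<alpha> = map Inl \<gamma> \<and> a = Inl c \<and> \<gamma> @ [c] \<in> traces \<G>) \<or>
        (\<exists>\<beta> e. \<alpha> = map Inr \<beta> \<and> a = Inr e \<and> \<beta> @ [e] \<in> traces \<E>)"
      using that(1) unfolding traces_plus by (auto simp: append_eq_map_conv Cons_eq_map_conv)
    then show thesis
    proof (elim disjE exE conjE)
      fix \<gamma> c assume \<gamma>: "\<alpha> = map Inl \<gamma>" "a = Inl c" "\<gamma> @ [c] \<in> traces \<G>"
      moreover have "c \<in> events \<G>"
        using \<gamma>(3) by (simp add: traces_snoc)
      ultimately show thesis
        by (rule that(2))
    qed (rule that(3))
  qed
  have "t_simulation ?P ?Q g"
  proof (rule t_simulationI)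
    show "g [] = []"
      by (simp add: g_def)
    show "g \<alpha> \<in> traces ?Q" if "\<alpha> \<in> traces ?P" for \<alpha>
      using that f by (auto simp: traces_plus g_Inl g_Inr t_simulation_def)
    show "finite {\<alpha> \<in> traces ?P. g \<alpha> = \<beta>}" if "\<beta> \<in> traces ?Q" for \<beta>
    proof (rule finite_subset)
      let ?B = "{\<gamma> \<in> traces \<E>. map Inr (f \<gamma>) = \<beta>}"
      show "{\<alpha> \<in> traces ?P. g \<alpha> = \<beta>} \<subseteq> insert (map Inl (lefts \<beta>)) (map Inr ` ?B)"
        by (auto simp: traces_plus g_Inl g_Inr lefts_Inl)
      have "finite ?B"
      \<comment> \<open>The set is empty unless \<open>\<beta>\<close> is the tagged image of some
        \<open>f \<gamma>\<close>; in that case injectivity of \<open>map Inr\<close> makes it a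
        fibre of \<open>f\<close>.\<close>
      proof (cases "\<exists>\<gamma>. \<gamma> \<in> ?B")
        case True
        then obtain \<gamma> where \<gamma>: "\<gamma> \<in> traces \<E>" "map Inr (f \<gamma>) = \<beta>"
          by blast
        then have "?B = {\<gamma>' \<in> traces \<E>. f \<gamma>' = f \<gamma>}"
          by (auto simp: inj_map_eq_map)
        then show ?thesis
          using f \<gamma>(1) by (simp add: t_simulation_def)
      next
        case False
        then have "?B = {}"
          by blast
        then show ?thesis
          by (metis finite.emptyI)
      qed
      then show "finite (insert (map Inl (lefts \<beta>)) (map Inr ` ?B))"
        by simp
    qed
  next
    fix \<alpha> a assume "\<alpha> @ [a] \<in> traces ?P"
    then show "g (\<alpha> @ [a]) = g \<alpha> \<and> label ?P a \<sqsubseteq>\<^sub>H skip \<or>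
        (\<exists>e'\<in>events ?Q. label ?P a \<sqsubseteq>\<^sub>H label ?Q e' \<and> g (\<alpha> @ [a]) = g \<alpha> @ [e'])"
    proof (rule cases_snoc)
      fix \<gamma> c assume "\<alpha> = map Inl \<gamma>" "a = Inl c" "c \<in> events \<G>"
      then show ?thesis
        using g_Inl[of "\<gamma> @ [c]"] g_Inl[of \<gamma>] by (auto simp: prog_le_def)
    next
      fix \<beta> e assume \<beta>: "\<alpha> = map Inr \<beta>" "a = Inr e" "\<beta> @ [e] \<in> traces \<E>"
      then have "f (\<beta> @ [e]) = f \<beta> \<and> label \<E> e \<sqsubseteq>\<^sub>H skip \<or>
          (\<exists>e'\<in>events \<F>. label \<E> e \<sqsubseteq>\<^sub>H label \<F> e' \<and> f (\<beta> @ [e]) = f \<beta> @ [e'])"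
        using f by (simp add: t_simulation_def)
      then show ?thesis
        using \<beta>(1,2) g_Inr[of "\<beta> @ [e]"] g_Inr[of \<beta>] by auto
    qed
  next
    fix \<alpha> a assume mx: "\<alpha> @ [a] \<in> max_traces ?P"
    then have "\<alpha> @ [a] \<in> traces ?P"
      by (simp add: max_traces_iff)
    then show "(\<exists>e'\<in>events ?Q. label ?P a \<sqsubseteq>\<^sub>H label ?Q e' \<and> g (\<alpha> @ [a]) = g \<alpha> @ [e']) \<and>
        g (\<alpha> @ [a]) \<in> weak_max_traces ?Q"
    proof (rule cases_snoc)
      fix \<gamma> c assume \<gamma>: "\<alpha> = map Inl \<gamma>" "a = Inl c" "c \<in> events \<G>"
      then have "\<gamma> @ [c] \<in> max_traces \<G>"
        using mx max_traces_plus(1)[of "\<gamma> @ [c]" \<G> \<E>] by simp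
      then have "map Inl (\<gamma> @ [c]) @ [] \<in> max_traces ?Q"
        using max_traces_plus(1)[of "\<gamma> @ [c]" \<G> \<F>] by simp
      then have "map Inl (\<gamma> @ [c]) \<in> weak_max_traces ?Q"
        by (rule weak_max_tracesI) simp
      then show ?thesis
        using \<gamma> g_Inl[of "\<gamma> @ [c]"] g_Inl[of \<gamma>] by (auto simp: prog_le_def)
    next
      fix \<beta> e assume \<beta>: "\<alpha> = map Inr \<beta>" "a = Inr e"
      then have "\<beta> @ [e] \<in> max_traces \<E>"
        using mx max_traces_plus(2)[of "\<beta> @ [e]" \<G> \<E>] by simp
      then have "\<exists>e'\<in>events \<F>. label \<E> e \<sqsubseteq>\<^sub>H label \<F> e' \<and> f (\<beta> @ [e]) = f \<beta> @ [e']"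
        and "f (\<beta> @ [e]) \<in> weak_max_traces \<F>"
        using f by (simp_all add: t_simulation_def)
      then obtain e' es where e': "e' \<in> events \<F>" "label \<E> e \<sqsubseteq>\<^sub>H label \<F> e'"
          "f (\<beta> @ [e]) = f \<beta> @ [e']"
        and es: "f (\<beta> @ [e]) @ es \<in> max_traces \<F>" "\<forall>e\<in>set es. skip \<sqsubseteq>\<^sub>H label \<F> e"
        using weak_max_tracesE[of "f (\<beta> @ [e])" \<F>] by metis
      have "map Inr (f (\<beta> @ [e])) @ map Inr es \<in> max_traces ?Q"
        using es(1) e'(3) max_traces_plus(2)[of "f (\<beta> @ [e]) @ es" \<G> \<F>] by simp
      then have "map Inr (f (\<beta> @ [e])) \<in> weak_max_traces ?Q"
        by (rule weak_max_tracesI) (use es(2) in auto)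
      then show ?thesis
        using \<beta> e' g_Inr[of "\<beta> @ [e]"] g_Inr[of \<beta>] by auto
    qed
  qed
  then show ?thesis
    by (auto simp: sim_le_def)
qed


section \<open>Unfolding the Kleene star\<close>

lemma trace_iso_trans:
  assumes "trace_iso h \<E> \<F>" and "trace_iso k \<F> \<G>"
  shows "trace_iso (k \<circ> h) \<E> \<G>"
  using assms by (auto simp: trace_iso_def image_image inj_compose)

text \<open>The second summand of the unfolding has another event type, hence a renamed copy
  \<open>\<Y>\<close>. Embedding on the left and folding the copies together both keep nonempty
  maximal traces maximal, since no trace mixes the summands.\<close>

lemma plus_idem:
  fixes \<F> :: "('a, 'w::finite) bes" and \<Y> :: "('b, 'w) bes"
  assumes iso: "trace_iso h \<F> \<Y>"
  shows "\<F> \<equiv>\<^sub>s\<^sub>i\<^sub>m bes_plus \<F> \<Y>"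
proof -
  have hinj: "inj h" and Y: "events \<Y> = h ` events \<F>" "traces \<Y> = map h ` traces \<F>"
    and lab: "\<forall>e\<in>events \<F>. label \<Y> (h e) = label \<F> e"
    using iso by (simp_all add: trace_iso_def)
  let ?S = "bes_plus \<F> \<Y>" and ?p = "case_sum id (inv h)"
  have p: "map ?p (map Inl \<alpha>) = \<alpha>" "map ?p (map Inr (map h \<alpha>)) = \<alpha>" for \<alpha>
    using hinj by (simp_all add: o_def)
  have "t_simulation \<F> ?S (map Inl)"
  proof (rule t_simulation_map)
    show "finite {e \<in> events \<F>. Inl e = (e' :: 'a + 'b)}" for e'
      by (rule finite_subset[of _ "{projl e'}"]) auto
  qed (auto simp: traces_plus max_traces_plus)
  moreover have "t_simulation ?S \<F> (map ?p)"
  proof (rule t_simulation_map)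
    show "map ?p \<alpha> \<in> traces \<F>" if "\<alpha> \<in> traces ?S" for \<alpha>
      using that hinj by (auto simp: traces_plus Y(2) o_def)
    show "map ?p \<alpha> \<in> max_traces \<F>" if mx: "\<alpha> \<in> max_traces ?S" "\<alpha> \<noteq> []" for \<alpha>
    proof -
      consider \<beta> where "\<alpha> = map Inl \<beta>" | \<beta> where "\<alpha> = map Inr (map h \<beta>)"
        using mx(1) by (auto simp: max_traces_iff traces_plus Y(2))
      then show ?thesis
      proof cases
        case 1
        then show ?thesis
          using mx by (auto simp: max_traces_plus o_def)
      next
        case 2
        then show ?thesis
          using mx map_in_max_traces_iff[OF iso] max_traces_plus(2)[of "map h \<beta>" \<F> \<Y>] p(2)
          by auto
      qed
    qed
    show "label \<F> (?p e) = label ?S e" if "e \<in> events ?S" for e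
      using that hinj lab by (auto simp: Y(1))
    \<comment> \<open>An event has at most two preimages, its copies in the two summands.\<close>
    show "finite {e \<in> events ?S. ?p e = e'}" for e'
      by (rule finite_subset[of _ "{Inl e', Inr (h e')}"]) (use hinj in \<open>auto simp: Y(1)\<close>)
  qed
  ultimately show ?thesis
    by (auto simp: sim_eq_def sim_le_def)
qed

lemma star_zero:
  assumes "is_zero \<E>"
  shows "bes_star \<E> \<F> \<equiv>\<^sub>s\<^sub>i\<^sub>m bes_plus \<F> (bes_seq \<E> (bes_star \<E> \<F>))"
proof -
  let ?h = "\<lambda>f. (0, Inr f)"
  have X: "trace_iso ?h \<F> (bes_star \<E> \<F>)"
    by (rule trace_isoI) (use assms in \<open>auto simp: bes_star_def inj_def\<close>)
  have "trace_iso Inr (bes_star \<E> \<F>) (bes_seq \<E> (bes_star \<E> \<F>))"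
  proof (rule trace_isoI)
    show "{x. (x, Inr a) \<in> bundles (bes_seq \<E> (bes_star \<E> \<F>))} =
        (`) Inr ` {x. (x, a) \<in> bundles (bes_star \<E> \<F>)}" for a
      using assms by (simp add: bes_seq_def bundles_par)
  qed (use assms in \<open>auto simp: bes_seq_def bes_par_def is_zero_def\<close>)
  then have "\<F> \<equiv>\<^sub>s\<^sub>i\<^sub>m bes_plus \<F> (bes_seq \<E> (bes_star \<E> \<F>))"
    using trace_iso_trans[OF X] plus_idem by blast
  then show ?thesis
    \<comment> \<open>The star takes the place of its copy \<open>\<F>\<close> by renaming, which
      stands in for transitivity.\<close>
    unfolding sim_eq_def
    using sim_le_trace_iso[OF X trace_iso_id] sim_le_trace_iso[OF trace_iso_id X] by blast
qed

text \<open>The shift from \<open>Suc k\<close> to \<open>k\<close> identifies all copies beyond the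
  first with the inner star, leaving copy 0 as the summand \<open>\<F>\<close> and the prefix
  \<open>\<E>\<close>.\<close>

fun star_unfold :: "nat \<times> ('a + 'b) \<Rightarrow> 'b + ('a + nat \<times> ('a + 'b))" where
  "star_unfold (0, Inr f) = Inl f"
| "star_unfold (0, Inl e) = Inr (Inl e)"
| "star_unfold (Suc k, z) = Inr (Inr (k, z))"

lemma inj_star_unfold: "inj star_unfold"
proof (rule injI)
  fix a b :: "nat \<times> ('a + 'b)"
  show "star_unfold a = star_unfold b \<Longrightarrow> a = b"
    by (cases a rule: star_unfold.cases; cases b rule: star_unfold.cases) simp_all
qed

section \<open>Conflicts, bundles, initial events and exits, computed event by event\<close>

lemma star_conflict_iff:
  "((k, Inl e), (j, Inl e')) \<in> star_conflict \<E> \<F> \<longleftrightarrow> k = j \<and> (e, e') \<in> conflict \<E>"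
  "((k, Inr f), (j, Inl e)) \<in> star_conflict \<E> \<F> \<longleftrightarrow>
     (k = j \<or> exits \<E> = {} \<and> k < j) \<and> f \<in> initial \<F> \<and> e \<in> initial \<E>"
  "((k, Inl e), (j, Inr f)) \<in> star_conflict \<E> \<F> \<longleftrightarrow>
     (k = j \<or> exits \<E> = {} \<and> j < k) \<and> f \<in> initial \<F> \<and> e \<in> initial \<E>"
  "((k, Inr f), (j, Inr f')) \<in> star_conflict \<E> \<F> \<longleftrightarrow>
     k = j \<and> (f, f') \<in> conflict \<F> \<or>
     k \<noteq> j \<and> (exits \<E> = {} \<and> f \<in> initial \<F> \<and> f' \<in> initial \<F> \<or>
       f \<in> \<Union>(exits \<F>) \<and> f' \<in> \<Union>(exits \<F>))"
  by (auto simp: star_conflict_def bes_par_def sym_closure_def)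

text \<open>A zero left operand is covered by the same formulas: it has neither initial events nor
  exit sets, so the right-hand sides vanish together with the cross conflicts. In the unfolding the
  left operand is \<open>\<F>\<close>, which may be zero.\<close>

lemma plus_conflict_iff:
  assumes "\<not> is_zero \<F>"
  shows
    "(Inl a, Inl a') \<in> conflict (bes_plus \<E> \<F>) \<longleftrightarrow> (a, a') \<in> conflict \<E>"
    "(Inr b, Inr b') \<in> conflict (bes_plus \<E> \<F>) \<longleftrightarrow> (b, b') \<in> conflict \<F>"
    "(Inl a, Inr b) \<in> conflict (bes_plus \<E> \<F>) \<longleftrightarrow>
       a \<in> initial \<E> \<and> b \<in> initial \<F> \<or> a \<in> \<Union>(exits \<E>) \<and> b \<in> \<Union>(exits \<F>)"
    "(Inr b, Inl a) \<in> conflict (bes_plus \<E> \<F>) \<longleftrightarrow>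
       a \<in> initial \<E> \<and> b \<in> initial \<F> \<or> a \<in> \<Union>(exits \<E>) \<and> b \<in> \<Union>(exits \<F>)"
  using assms by (auto simp: bes_plus_def bes_par_def sym_closure_def is_zero_def initial_def)

lemma seq_conflict_iff:
  "(Inl a, Inl a') \<in> conflict (bes_seq \<E> \<F>) \<longleftrightarrow> (a, a') \<in> conflict \<E>"
  "(Inr b, Inr b') \<in> conflict (bes_seq \<E> \<F>) \<longleftrightarrow> (b, b') \<in> conflict \<F>"
  "(Inl a, Inr b) \<notin> conflict (bes_seq \<E> \<F>)" "(Inr b, Inl a) \<notin> conflict (bes_seq \<E> \<F>)"
  by (auto simp: bes_seq_def bes_par_def)

lemma bundles_seq:
  assumes "\<not> is_zero \<E>" and "\<not> is_zero \<F>"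
  shows
    "{x. (x, Inl a) \<in> bundles (bes_seq \<E> \<F>)} = (`) Inl ` {x. (x, a) \<in> bundles \<E>}"
    "{x. (x, Inr b) \<in> bundles (bes_seq \<E> \<F>)} = (`) Inr ` {x. (x, b) \<in> bundles \<F>} \<union>
       (if b \<in> initial \<F> then (`) Inl ` exits \<E> else {})"
  using assms by (auto simp: bes_seq_def bes_par_def)

text \<open>Without exit sets \<open>\<E>\<close> guards nothing, which is the source of the case
  \<open>exits \<E> = {}\<close> in \<open>star_conflict\<close>.\<close>

lemma initial_seq:
  assumes "\<not> is_zero \<E>" and "\<not> is_zero \<F>"
  shows "Inl a \<in> initial (bes_seq \<E> \<F>) \<longleftrightarrow> a \<in> initial \<E>"
    and "Inr b \<in> initial (bes_seq \<E> \<F>) \<longleftrightarrow> exits \<E> = {} \<and> b \<in> initial \<F>"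
  using bundles_seq(1)[OF assms, of a] bundles_seq(2)[OF assms, of b]
  by (auto simp: initial_def split: if_splits)

lemma exits_seq:
  assumes "\<not> is_zero \<E>" and "\<not> is_zero \<F>"
  shows "Inl a \<notin> \<Union>(exits (bes_seq \<E> \<F>))"
    and "Inr b \<in> \<Union>(exits (bes_seq \<E> \<F>)) \<longleftrightarrow> b \<in> \<Union>(exits \<F>)"
  using assms by (auto simp: bes_seq_def)

lemma star_simps:
  assumes "\<not> is_zero \<E>"
  shows "events (bes_star \<E> \<F>) = UNIV \<times> (Inl ` events \<E> \<union> Inr ` events \<F>)"
    and "conflict (bes_star \<E> \<F>) = star_conflict \<E> \<F>"
    and "{x. (x, (0, z)) \<in> bundles (bes_star \<E> \<F>)} =
      (`) (Pair 0) ` {x. (x, z) \<in> bundles (bes_par \<E> \<F>)}"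
    and "{x. (x, (Suc k, z)) \<in> bundles (bes_star \<E> \<F>)} =
      (`) (Pair (Suc k)) ` {x. (x, z) \<in> bundles (bes_par \<E> \<F>)} \<union>
      (if z \<in> Inr ` initial \<F> \<union> Inl ` initial \<E> then (`) (\<lambda>e. (k, Inl e)) ` exits \<E> else {})"
  using assms by (auto simp: bes_star_def)

lemma exits_star:
  assumes "\<not> is_zero \<E>"
  shows "(k, Inl e) \<notin> \<Union>(exits (bes_star \<E> \<F>))"
    and "(k, Inr f) \<in> \<Union>(exits (bes_star \<E> \<F>)) \<longleftrightarrow> f \<in> \<Union>(exits \<F>)"
proof -
  show "(k, Inl e) \<notin> \<Union>(exits (bes_star \<E> \<F>))"
    using assms by (auto simp: bes_star_def)
  have "(k, Inr f) \<in> \<Union>(exits (bes_star \<E> \<F>))" if "f \<in> x" "x \<in> exits \<F>" for x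
  proof (rule UnionI)
    \<comment> \<open>An exit set of the star selects one exit set per copy; selecting
      \<open>x\<close> in every copy covers copy \<open>k\<close>.\<close>
    show "(\<Union>k. (\<lambda>f. (k, Inr f)) ` x) \<in> exits (bes_star \<E> \<F>)"
      using that assms by (auto simp: bes_star_def intro!: exI[of _ "\<lambda>_. x"])
  qed (use that in auto)
  then show "(k, Inr f) \<in> \<Union>(exits (bes_star \<E> \<F>)) \<longleftrightarrow> f \<in> \<Union>(exits \<F>)"
    using assms by (auto simp: bes_star_def)
qed

text \<open>Each copy beyond the first is guarded by the exit sets of the preceding copy of
  \<open>\<E>\<close>, so it has initial events only if there are no such sets.\<close>

lemma initial_star:
  assumes "\<not> is_zero \<E>"
  shows "(k, z) \<in> initial (bes_star \<E> \<F>) \<longleftrightarrow>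
    (k = 0 \<or> exits \<E> = {}) \<and> z \<in> Inr ` initial \<F> \<union> Inl ` initial \<E>"
proof -
  define A where "A = Inr ` initial \<F> \<union> Inl ` initial \<E>"
  define V where "V = Inl ` events \<E> \<union> Inr ` events \<F>"
  define B where "B = {x. (x, z) \<in> bundles (bes_par \<E> \<F>)}"
  have par: "z \<in> A \<longleftrightarrow> z \<in> V \<and> B = {}"
    by (cases z) (auto simp: A_def V_def B_def initial_def bundles_par)
  have star: "(k, z) \<in> initial (bes_star \<E> \<F>) \<longleftrightarrow>
      z \<in> V \<and> {x. (x, (k, z)) \<in> bundles (bes_star \<E> \<F>)} = {}"
    using star_simps(1)[OF assms] by (auto simp: initial_def V_def)
  have "(k, z) \<in> initial (bes_star \<E> \<F>) \<longleftrightarrow> (k = 0 \<or> exits \<E> = {}) \<and> z \<in> A"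
  proof (cases k)
    case 0
    show ?thesis
      using star par unfolding 0 star_simps(3)[OF assms] B_def[symmetric] by simp
  next
    case (Suc j)
    show ?thesis
      using star par unfolding Suc star_simps(4)[OF assms] A_def[symmetric] B_def[symmetric]
      by auto
  qed
  then show ?thesis
    by (simp only: A_def)
qed

text \<open>Conflicts between copy 0 and a later copy come from the outer sum; those among later
  copies come from the inner star. Sequencing adds bundles in front of the initial events of the
  inner star. By \<open>initial_star\<close> these lie in its first copy, or else
  \<open>exits \<E> = {}\<close> and nothing is added.\<close>

lemma trace_iso_star_unfold:
  assumes "\<not> is_zero \<E>"
  shows "trace_iso star_unfold (bes_star \<E> \<F>) (bes_plus \<F> (bes_seq \<E> (bes_star \<E> \<F>)))"
proof -
  let ?X = "bes_star \<E> \<F>"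
  let ?S = "bes_seq \<E> ?X"
  note simps = star_simps[OF assms]
  \<comment> \<open>The star can be zero although \<open>\<E>\<close> is not: let
    \<open>\<E>\<close> have no events and the single exit set \<open>{}\<close>, and let
    \<open>\<F>\<close> be zero. An event at hand excludes this, and without events the claims on
    conflicts and bundles are vacuous.\<close>
  have nz: "\<not> is_zero ?X" "\<not> is_zero ?S" if "a \<in> events ?X" for a
    using that by (auto simp: is_zero_def)
  show ?thesis
  proof (rule trace_isoI)
    show "events (bes_plus \<F> ?S) = star_unfold ` events ?X"
    proof (intro equalityI subsetI)
      fix a assume "a \<in> events (bes_plus \<F> ?S)"
      then consider f where "a = star_unfold (0, Inr f)" "f \<in> events \<F>"
        | e where "a = star_unfold (0, Inl e)" "e \<in> events \<E>"
        | k z where "a = star_unfold (Suc k, z)" "z \<in> Inl ` events \<E> \<union> Inr ` events \<F>"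
        by (auto simp: simps(1))
      then show "a \<in> star_unfold ` events ?X"
        by cases (auto simp: simps(1) simp del: star_unfold.simps)
    next
      fix a assume "a \<in> star_unfold ` events ?X"
      then obtain b where "a = star_unfold b" "b \<in> events ?X"
        by blast
      then show "a \<in> events (bes_plus \<F> ?S)"
        by (cases b rule: star_unfold.cases) (auto simp: simps(1))
    qed
    show "label (bes_plus \<F> ?S) (star_unfold a) = label ?X a" for a
      using assms by (cases a rule: star_unfold.cases) (simp_all add: bes_star_def)
  next
    fix a b assume "a \<in> events ?X"
    note nz = nz[OF this]
    show "(star_unfold a, star_unfold b) \<in> conflict (bes_plus \<F> ?S) \<longleftrightarrow> (a, b) \<in> conflict ?X"
    proof -
      \<comment> \<open>Star conflicts depend only on how the two indices compare, which the shift
        preserves.\<close>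
      have shift: "((k, z), (j, w)) \<in> star_conflict \<E> \<F> \<longleftrightarrow>
          ((Suc k, z), (Suc j, w)) \<in> star_conflict \<E> \<F>" for k j z w
        by (cases z; cases w) (simp_all add: star_conflict_iff)
      have "(star_unfold (0, z), star_unfold (Suc j, w)) \<in> conflict (bes_plus \<F> ?S) \<longleftrightarrow>
          ((0, z), (Suc j, w)) \<in> star_conflict \<E> \<F>" for j z w
        by (cases z; cases w) (auto simp del: Union_iff simp: plus_conflict_iff[OF nz(2)] seq_conflict_iff star_conflict_iff
            initial_seq[OF assms nz(1)] exits_seq[OF assms nz(1)] exits_star[OF assms] initial_star[OF assms])
      moreover have "(star_unfold (Suc j, w), star_unfold (0, z)) \<in> conflict (bes_plus \<F> ?S) \<longleftrightarrow>
          ((Suc j, w), (0, z)) \<in> star_conflict \<E> \<F>" for j z w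
        by (cases z; cases w) (auto simp del: Union_iff simp: plus_conflict_iff[OF nz(2)] seq_conflict_iff star_conflict_iff
            initial_seq[OF assms nz(1)] exits_seq[OF assms nz(1)] exits_star[OF assms] initial_star[OF assms])
      moreover have "(star_unfold (0, z), star_unfold (0, w)) \<in> conflict (bes_plus \<F> ?S) \<longleftrightarrow>
          ((0, z), (0, w)) \<in> star_conflict \<E> \<F>" for z w
        by (cases z; cases w) (auto simp del: Union_iff simp: plus_conflict_iff[OF nz(2)] seq_conflict_iff star_conflict_iff
            initial_seq[OF assms nz(1)] exits_seq[OF assms nz(1)])
      moreover have "(star_unfold (Suc k, z), star_unfold (Suc j, w)) \<in> conflict (bes_plus \<F> ?S) \<longleftrightarrow>
          ((Suc k, z), (Suc j, w)) \<in> star_conflict \<E> \<F>" for k j z w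
        by (simp add: plus_conflict_iff[OF nz(2)] seq_conflict_iff simps(2) shift[symmetric])
      moreover obtain k z j w where "a = (k, z)" "b = (j, w)"
        using surj_pair[of a] surj_pair[of b] by blast
      ultimately show ?thesis
        unfolding simps(2) by (cases k; cases j) simp_all
    qed
  next
    fix a assume "a \<in> events ?X"
    note nz = nz[OF this]
    show "{x. (x, star_unfold a) \<in> bundles (bes_plus \<F> ?S)} =
        (`) star_unfold ` {x. (x, a) \<in> bundles ?X}"
    proof (cases a rule: star_unfold.cases)
      case (1 f)
      then show ?thesis
        by (simp add: bundles_plus bundles_par simps(3) image_image)
    next
      case (2 e)
      then show ?thesis
        by (simp add: bundles_plus bundles_par simps(3) bundles_seq[OF assms nz(1)] image_image)
    next
      case (3 k z)
      then show ?thesis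
        by (cases k) (auto simp: bundles_plus bundles_par simps(3,4) bundles_seq[OF assms nz(1)]
            initial_star[OF assms] image_image image_Un)
    qed
  qed (rule inj_star_unfold)
qed

theorem proposition4p12:
  fixes \<E> :: "('a, 'w::finite) bes"
    and \<F> :: "('b, 'w) bes"
    and \<G> :: "('c, 'w) bes"
  assumes "ipBES \<E>" and "ipBES \<F>" and "ipBES \<G>"
  shows "bes_par \<E> \<F> \<equiv>\<^sub>s\<^sub>i\<^sub>m bes_par \<F> \<E> \<and>
    bes_par \<E> (bes_par \<F> \<G>) \<equiv>\<^sub>s\<^sub>i\<^sub>m bes_par (bes_par \<E> \<F>) \<G> \<and>
    bes_star \<E> \<F> \<equiv>\<^sub>s\<^sub>i\<^sub>m bes_plus \<F> (bes_seq \<E> (bes_star \<E> \<F>)) \<and>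
    (\<E> \<sqsubseteq>\<^sub>s\<^sub>i\<^sub>m \<F> \<longrightarrow> bes_plus \<G> \<E> \<sqsubseteq>\<^sub>s\<^sub>i\<^sub>m bes_plus \<G> \<F>) \<and>
    (\<E> \<sqsubseteq>\<^sub>s\<^sub>i\<^sub>m \<F> \<and> ([] \<in> max_traces \<E> \<longrightarrow> [] \<in> weak_max_traces \<F>)
      \<longrightarrow> bes_seq \<G> \<E> \<sqsubseteq>\<^sub>s\<^sub>i\<^sub>m bes_seq \<G> \<F>) \<and>
    (\<E> \<sqsubseteq>\<^sub>s\<^sub>i\<^sub>m \<F> \<and> ([] \<in> max_traces \<E> \<longrightarrow> [] \<in> weak_max_traces \<F>)
      \<longrightarrow> bes_par \<E> \<G> \<sqsubseteq>\<^sub>s\<^sub>i\<^sub>m bes_par \<F> \<G>)"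
proof (intro conjI impI)
  show "bes_par \<E> \<F> \<equiv>\<^sub>s\<^sub>i\<^sub>m bes_par \<F> \<E>"
    by (rule trace_iso_sim_eq[OF trace_iso_par_commute])
  show "bes_par \<E> (bes_par \<F> \<G>) \<equiv>\<^sub>s\<^sub>i\<^sub>m bes_par (bes_par \<E> \<F>) \<G>"
    by (rule trace_iso_sim_eq[OF trace_iso_par_assoc])
  show "bes_star \<E> \<F> \<equiv>\<^sub>s\<^sub>i\<^sub>m bes_plus \<F> (bes_seq \<E> (bes_star \<E> \<F>))"
    using star_zero trace_iso_sim_eq[OF trace_iso_star_unfold] by blast
next
  assume "\<E> \<sqsubseteq>\<^sub>s\<^sub>i\<^sub>m \<F>"
  then show "bes_plus \<G> \<E> \<sqsubseteq>\<^sub>s\<^sub>i\<^sub>m bes_plus \<G> \<F>"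
    by (rule plus_mono_right)
next
  assume *: "\<E> \<sqsubseteq>\<^sub>s\<^sub>i\<^sub>m \<F> \<and> ([] \<in> max_traces \<E> \<longrightarrow> [] \<in> weak_max_traces \<F>)"
  then show "bes_seq \<G> \<E> \<sqsubseteq>\<^sub>s\<^sub>i\<^sub>m bes_seq \<G> \<F>"
    by (intro seq_mono_right) simp_all
  \<comment> \<open>The lifting acts on the right operand; commuting both compositions moves it to
    the left one.\<close>
  have "bes_par \<G> \<E> \<sqsubseteq>\<^sub>s\<^sub>i\<^sub>m bes_par \<G> \<F>"
    using * by (intro par_mono_right) simp_all
  then show "bes_par \<E> \<G> \<sqsubseteq>\<^sub>s\<^sub>i\<^sub>m bes_par \<F> \<G>"
    by (rule sim_le_trace_iso[OF trace_iso_par_commute trace_iso_par_commute])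
qed

end
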